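(* Let $\{g_t\}_{t\ge1}$ be the family of total Boolean functions $g_t:\{0,1\}^{29^t}\to\{0,1\}$ defined as follows: $g_1(x_1,\ldots,x_{29})=1$ if and only if the Hamming weight of $(x_1,\ldots,x_{29})$ is $13$, $14$, $15$, or $16$; and for $t>1$, $$g_t(x_1,\ldots,x_{29^t})=g_1\left(g_{t-1}(X_1),\ldots,g_{t-1}(X_{29})\right),$$ where $X_1$ is the first block of $29^{t-1}$ input bits, $X_2$ the second block of $29^{t-1}$ input bits, and so on. Then $$C(g_t)=\Theta\left(QC(g_t)^{2.205}\right).$$
   Context: Let $f:\{0,1\}^n\to\{0,1\}$ be a total Boolean function. A certificate for an input $X$ is a set $S\subseteq\{1,\ldots,n\}$ such that for all $Y\in\{0,1\}^n$, if $y_i=x_i$ for all $i\in S$ then $f(Y)=f(X)$. $C^X(f)$ is the minimum size of a certificate for $X$, and $C(f)=\max_X C^X(f)$. A quantum verifier for an input $X$ is a quantum query algorithm, accessing its input $Y\in\{0,1\}^n$ only through queries to the bits $y_i$, that (i) accepts with probability $1$ if $Y=X$, and (ii) rejects with probability at least $1/2$ if $f(Y)\neq f(X)$ (if $Y\ne X$ but $f(Y)=f(X)$ the acceptance probability can be arbitrary). The algorithm may depend on $X$ and $f$. $QC^X(f)$ is the minimum number of queries used by a quantum verifier for $X$, and $QC(f)=\max_X QC^X(f)$.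
   Formalization: The exponent 2.205 is read as a rounded decimal: some exponent within 0.0005 of 2.205 is asserted, since the only exponent that works is 2 ln((13+√1053)/2)/ln 17 = 2.20489..., and the claim with exactly 2.205 is false. *)

theory Defs
  imports
    Complex_Main
    "HOL-Library.Landau_Symbols"
    "Jordan_Normal_Form.Schur_Decomposition"
begin

(* Inputs in {0,1}^n are lists of length n; positions are counted from 0. A Boolean function on
   {0,1}^n is given by n together with a predicate on lists, only used on lists of length n. *)

definition cube :: "nat \<Rightarrow> bool list set" where
  "cube n = {x. length x = n}"


section \<open>Certificate complexity\<close>

definition is_certificate :: "nat \<Rightarrow> (bool list \<Rightarrow> bool) \<Rightarrow> bool list \<Rightarrow> nat set \<Rightarrow> bool" where
  "is_certificate n f x S \<longleftrightarrow>
     S \<subseteq> {..<n} \<and> (\<forall>y\<in>cube n. (\<forall>i\<in>S. y ! i = x ! i) \<longrightarrow> f y = f x)"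

definition cert_at :: "nat \<Rightarrow> (bool list \<Rightarrow> bool) \<Rightarrow> bool list \<Rightarrow> nat" where
  "cert_at n f x = (LEAST k. \<exists>S. is_certificate n f x S \<and> card S = k)"

definition cert :: "nat \<Rightarrow> (bool list \<Rightarrow> bool) \<Rightarrow> nat" where
  "cert n f = Max (cert_at n f ` cube n)"


section \<open>Quantum query algorithms\<close>

(* The state space has the computational basis |i,b,z> with a query position i < n, an answer
   bit b and a workspace value z < w. Jordan_Normal_Form vectors are indexed by naturals, so
   |i,b,z> is put at position (2 i + b) w + z. *)

definition basis_index :: "nat \<Rightarrow> nat \<Rightarrow> bool \<Rightarrow> nat \<Rightarrow> nat" where
  "basis_index w i b z = (2 * i + of_bool b) * w + z"

definition state_dim :: "nat \<Rightarrow> nat \<Rightarrow> nat" where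
  "state_dim n w = n * 2 * w"

(* The query to y is the permutation |i,b,z> -> |i, b xor y_i, z>. *)

definition query_mat :: "nat \<Rightarrow> nat \<Rightarrow> bool list \<Rightarrow> complex mat" where
  "query_mat n w y = mat (state_dim n w) (state_dim n w)
     (\<lambda>(r, c). of_bool (\<exists>i<n. \<exists>b. \<exists>z<w.
        c = basis_index w i b z \<and> r = basis_index w i (b \<noteq> y ! i) z))"

definition unitary_mat :: "nat \<Rightarrow> complex mat \<Rightarrow> bool" where
  "unitary_mat d U \<longleftrightarrow> U \<in> carrier_mat d d \<and> mat_adjoint U * U = 1\<^sub>m d"

(* An algorithm with T queries applies U_T Q_y U_(T-1) ... Q_y U_0 to |0,0,0>, measures in the
   computational basis and accepts iff the outcome lies in the set of accepting basis states. *)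

record query_algorithm =
  workspace :: nat
  queries :: nat
  unitaries :: "nat \<Rightarrow> complex mat"
  accepting :: "nat set"

definition valid_algorithm :: "nat \<Rightarrow> query_algorithm \<Rightarrow> bool" where
  "valid_algorithm n A \<longleftrightarrow>
     workspace A > 0 \<and>
     (\<forall>j\<le>queries A. unitary_mat (state_dim n (workspace A)) (unitaries A j)) \<and>
     accepting A \<subseteq> {..<state_dim n (workspace A)}"

primrec state_after :: "nat \<Rightarrow> query_algorithm \<Rightarrow> bool list \<Rightarrow> nat \<Rightarrow> complex vec" where
  "state_after n A y 0 =
     unitaries A 0 *\<^sub>v unit_vec (state_dim n (workspace A)) (basis_index (workspace A) 0 False 0)"
| "state_after n A y (Suc j) =
     unitaries A (Suc j) *\<^sub>v (query_mat n (workspace A) y *\<^sub>v state_after n A y j)"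

definition accept_prob :: "nat \<Rightarrow> query_algorithm \<Rightarrow> bool list \<Rightarrow> real" where
  "accept_prob n A y = (\<Sum>k\<in>accepting A. (cmod (state_after n A y (queries A) $ k))\<^sup>2)"

definition reject_prob :: "nat \<Rightarrow> query_algorithm \<Rightarrow> bool list \<Rightarrow> real" where
  "reject_prob n A y = 1 - accept_prob n A y"


section \<open>Quantum certificate complexity\<close>

definition quantum_verifier ::
  "nat \<Rightarrow> (bool list \<Rightarrow> bool) \<Rightarrow> bool list \<Rightarrow> query_algorithm \<Rightarrow> bool" where
  "quantum_verifier n f x A \<longleftrightarrow>
     valid_algorithm n A \<and>
     accept_prob n A x = 1 \<and>
     (\<forall>y\<in>cube n. f y \<noteq> f x \<longrightarrow> reject_prob n A y \<ge> 1 / 2)"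

definition qcert_at :: "nat \<Rightarrow> (bool list \<Rightarrow> bool) \<Rightarrow> bool list \<Rightarrow> nat" where
  "qcert_at n f x = (LEAST T. \<exists>A. quantum_verifier n f x A \<and> queries A = T)"

definition qcert :: "nat \<Rightarrow> (bool list \<Rightarrow> bool) \<Rightarrow> nat" where
  "qcert n f = Max (qcert_at n f ` cube n)"


section \<open>The family of functions\<close>

definition block :: "nat \<Rightarrow> nat \<Rightarrow> bool list \<Rightarrow> bool list" where
  "block m j x = take m (drop (j * m) x)"

definition g1 :: "bool list \<Rightarrow> bool" where
  "g1 x \<longleftrightarrow> count_list x True \<in> {13, 14, 15, 16}"

(* The family starts at index 1; the value at index 0 is a dummy. *)

fun g :: "nat \<Rightarrow> bool list \<Rightarrow> bool" where
  "g 0 x = False"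
| "g (Suc 0) x = g1 x"
| "g (Suc (Suc t)) x = g1 (map (\<lambda>j. g (Suc t) (block (29 ^ Suc t) j x)) [0..<29])"

(* On the exponent 2.205: it is a decimal approximation. C(g_t) grows like L^t with
   L = (13 + sqrt 1053) / 2, and QC(g_t) like 17^(t/2), so the only exponent e for which C(g_t)
   is of the exact order QC(g_t)^e is 2 ln L / ln 17 = 2.20489..., and the relation fails for
   e = 441/200. Results about the exponent therefore assert an exponent that equals 2.205 when
   rounded to three decimals. *)

end

(* Both complexities are computed by following how their witnesses behave under composition.

   A certificate of a composed function consists of a certificate of the outer function together with
   certificates of the inner function on the chosen blocks. For g_1 the worst inputs need 13 ones and
   13 zeros (value 1), or 17 ones (value 0), so C(g_t) grows like the t-th power of the positive root L
   of L^2 = 13 L + 13 * 17.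

   For quantum certificates the two witnesses are fractional certificates (amplitude amplification
   searches for a disagreement with X, sampled from the normalised weights) and families of inputs Y_k
   with f(Y_k) different from f(X) which differ from X on disjoint sets (a hybrid argument). On every
   input g_1 has a fractional certificate of weight at most 17, for either value some input has 17
   disjoint sensitive blocks, and both quantities are multiplicative, so QC(g_t) has the order of
   sqrt(17)^t. *)

theory Submission
  imports Defs "HOL-Analysis.L2_Norm"
begin

section \<open>Composition of Boolean functions\<close>

text \<open>The gap between the two measures comes from the 16 zeros of an input of weight 13: they
  form only 4 disjoint sensitive blocks, because 4 flips are needed to leave the window, but a
  certificate has to fix 13 of them. Together with the 13 ones this gives 17 against 26. The two
  values need separate treatment. Certificate costs differ between them and obey a linear recursion
  in two unknowns, whose exact solution serves as the induction bound in both directions. A flip of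
  an outer bit may turn an inner value either way, so sensitive families multiply only because 17
  blocks are available at some input of each value. The quantum obstacle is certain acceptance of X
  while the marked weight of other inputs is known only from below: after a fixed number of Grover
  iterations the state may have rotated back to its start. Iteration counts 1, ..., K are therefore
  run in superposition and the result is compared with the initial amplitudes. The averaged overlap
  is exactly 1 if nothing is marked, and its square is at most 1/2 once K^2 times the marked weight
  is at least 2.\<close>

definition block_compose :: "nat \<Rightarrow> nat \<Rightarrow> (bool list \<Rightarrow> bool) \<Rightarrow> (bool list \<Rightarrow> bool) \<Rightarrow> bool list \<Rightarrow> bool" where
  "block_compose n m f h x = f (map (\<lambda>j. h (block m j x)) [0..<n])"

definition glue :: "nat \<Rightarrow> nat \<Rightarrow> (nat \<Rightarrow> bool list) \<Rightarrow> bool list" where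
  "glue n m B = map (\<lambda>k. B (k div m) ! (k mod m)) [0..<n * m]"

lemma mult_add_less: "j * m + i < n * m" if "j < n" "i < m" for i j m n :: nat
proof -
  have "j * m + i < Suc j * m" using that by simp
  also have "\<dots> \<le> n * m" using that by (intro mult_right_mono) auto
  finally show ?thesis .
qed

lemma glue_in_cube: "glue n m B \<in> cube (n * m)"
  by (simp add: glue_def cube_def)

lemma glue_nth: "glue n m B ! (j * m + i) = B j ! i" if "j < n" "i < m"
  using mult_add_less[OF that] that by (simp add: glue_def)

lemma block_in_cube: "block m j x \<in> cube m" if "x \<in> cube (n * m)" "j < n"
proof -
  have "j * m + m \<le> n * m"
    using mult_right_mono[of "Suc j" n m] that by simp
  then show ?thesis using that by (simp add: block_def cube_def)
qed

lemma block_nth: "block m j x ! i = x ! (j * m + i)" if "x \<in> cube (n * m)" "j < n" "i < m"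
  using mult_add_less[OF that(2,3)] that by (simp add: block_def cube_def)

lemma block_glue: "block m j (glue n m B) = B j" if "j < n" "B j \<in> cube m"
proof (rule nth_equalityI)
  show "length (block m j (glue n m B)) = length (B j)"
    using block_in_cube[OF glue_in_cube that(1)] that(2) by (simp add: cube_def)
  show "block m j (glue n m B) ! i = B j ! i" if "i < length (block m j (glue n m B))" for i
    using that block_in_cube[OF glue_in_cube \<open>j < n\<close>] \<open>j < n\<close>
    by (auto simp: cube_def block_nth[OF glue_in_cube] glue_nth)
qed

lemma block_compose_glue:
  "block_compose n m f h (glue n m B) = f (map (\<lambda>j. h (B j)) [0..<n])" if "\<And>j. j < n \<Longrightarrow> B j \<in> cube m"
proof -
  have "map (\<lambda>j. h (block m j (glue n m B))) [0..<n] = map (\<lambda>j. h (B j)) [0..<n]"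
    using that by (auto simp: block_glue)
  then show ?thesis by (simp only: block_compose_def)
qed

lemma cube_map_upt [simp]: "map f [0..<n] \<in> cube n"
  by (simp add: cube_def)

lemma finite_cube: "finite (cube n)"
  using finite_lists_length_eq[of "UNIV :: bool set" n] by (simp add: cube_def)

lemma cube_nonempty: "cube n \<noteq> {}"
  using glue_in_cube[of n 1] by auto

text \<open>With the one-bit identity at index 0, the first level is a composition as well, so every
  induction over the family has a trivial base case on a single bit.\<close>

fun G :: "nat \<Rightarrow> bool list \<Rightarrow> bool" where
  "G 0 = (\<lambda>x. x ! 0)"
| "G (Suc t) = block_compose 29 (29 ^ t) g1 (G t)"

lemma g_eq_G: "g (Suc t) x = G (Suc t) x" if "x \<in> cube (29 ^ Suc t)"
  using that
proof (induction t arbitrary: x)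
  case 0
  have "map (\<lambda>j. block 1 j x ! 0) [0..<29] = x"
    using 0 by (intro nth_equalityI) (auto simp: cube_def block_def)
  then show ?case by (simp add: block_compose_def)
next
  case (Suc t)
  have "map (\<lambda>j. g (Suc t) (block (29 ^ Suc t) j x)) [0..<29]
      = map (\<lambda>j. G (Suc t) (block (29 ^ Suc t) j x)) [0..<29]"
    using Suc.prems by (intro map_cong refl Suc.IH block_in_cube[of _ 29]) auto
  then show ?case by (simp only: g.simps(3) G.simps(2)[of "Suc t"] block_compose_def)
qed

lemma count_list_cube: "count_list x b = card {j. j < n \<and> x ! j = b}" if "x \<in> cube n"
  using that by (simp add: cube_def count_list_eq_length_filter length_filter_conv_card eq_commute)

definition weight :: "nat \<Rightarrow> bool list \<Rightarrow> nat" where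
  "weight n x = card {j. j < n \<and> x ! j}"

lemma g1_iff: "g1 x \<longleftrightarrow> 13 \<le> weight 29 x \<and> weight 29 x \<le> 16" if "x \<in> cube 29"
  using count_list_cube[OF that, of True] by (auto simp: g1_def weight_def)

lemma card_zeros: "card {j. j < n \<and> \<not> x ! j} = n - weight n x"
proof -
  have "{j. j < n \<and> \<not> x ! j} = {..<n} - {j. j < n \<and> x ! j}" by auto
  then show ?thesis by (simp add: weight_def card_Diff_subset subset_iff)
qed

lemma weight_le: "weight n x \<le> n"
  unfolding weight_def using card_mono[of "{..<n}" "{j. j < n \<and> x ! j}"] by auto

section \<open>Certificate complexity of the family\<close>

lemma certificateI:
  assumes "S \<subseteq> {..<n}"
    and "\<And>y. \<lbrakk>y \<in> cube n; \<And>i. i \<in> S \<Longrightarrow> y ! i = x ! i\<rbrakk> \<Longrightarrow> f y = f x"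
  shows "is_certificate n f x S"
  using assms by (simp add: is_certificate_def)

lemma certificateD: "\<lbrakk>is_certificate n f x S; y \<in> cube n; \<forall>i\<in>S. y ! i = x ! i\<rbrakk> \<Longrightarrow> f y = f x"
  by (simp add: is_certificate_def)

lemma compose_certificateI:
  assumes x: "x \<in> cube (n * m)"
    and S: "\<And>j. j \<in> T \<Longrightarrow> is_certificate m h (block m j x) (S j)"
    and T: "is_certificate n f (map (\<lambda>j. h (block m j x)) [0..<n]) T"
  shows "is_certificate (n * m) (block_compose n m f h) x (\<Union>j\<in>T. (\<lambda>i. j * m + i) ` S j)"
  unfolding is_certificate_def
proof (intro conjI ballI impI)
  have sub: "T \<subseteq> {..<n}" "\<And>j. j \<in> T \<Longrightarrow> S j \<subseteq> {..<m}"
    using S T by (auto simp: is_certificate_def)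
  show "(\<Union>j\<in>T. (\<lambda>i. j * m + i) ` S j) \<subseteq> {..<n * m}"
    using sub by (auto intro!: mult_add_less)
  fix y assume y: "y \<in> cube (n * m)" and agree: "\<forall>i\<in>\<Union>j\<in>T. (\<lambda>i. j * m + i) ` S j. y ! i = x ! i"
  have "h (block m j y) = h (block m j x)" if j: "j \<in> T" for j
  proof -
    have "\<forall>i\<in>S j. block m j y ! i = block m j x ! i"
      using agree j sub by (auto simp: block_nth[OF x] block_nth[OF y] subset_iff)
    then show ?thesis using S[OF j] block_in_cube[OF y, of j] j sub(1) certificateD by blast
  qed
  moreover have "j < n" if "j \<in> T" for j using sub(1) that by auto
  ultimately have "\<forall>j\<in>T. map (\<lambda>j. h (block m j y)) [0..<n] ! j = map (\<lambda>j. h (block m j x)) [0..<n] ! j"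
    by simp
  then show "block_compose n m f h y = block_compose n m f h x"
    unfolding block_compose_def using T by (intro certificateD[of n f _ T]) auto
qed

text \<open>In a block where the restriction of \<open>S\<close> certifies nothing, the inner value
  can be changed while agreeing with \<open>S\<close>. Hence any outer input that agrees on the
  remaining blocks is realised by gluing, and those blocks must already determine the outer
  value.\<close>

lemma compose_certificateD:
  assumes x: "x \<in> cube (n * m)" and S: "is_certificate (n * m) (block_compose n m f h) x S"
  shows "is_certificate n f (map (\<lambda>j. h (block m j x)) [0..<n])
    {j. j < n \<and> is_certificate m h (block m j x) {i. i < m \<and> j * m + i \<in> S}}"
    (is "is_certificate n f ?z ?A")
proof (intro certificateI)
  show "?A \<subseteq> {..<n}" by auto
  fix z assume z: "z \<in> cube n" and agree: "\<And>j. j \<in> ?A \<Longrightarrow> z ! j = ?z ! j"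
  have "\<exists>y\<in>cube m. (\<forall>i<m. j * m + i \<in> S \<longrightarrow> y ! i = block m j x ! i) \<and> h y = z ! j" if "j < n" for j
  proof (cases "z ! j = ?z ! j")
    case True
    then show ?thesis using that block_in_cube[OF x that] by auto
  next
    case False
    then have "\<not> is_certificate m h (block m j x) {i. i < m \<and> j * m + i \<in> S}"
      using agree that by blast
    then obtain y where "y \<in> cube m" "\<forall>i<m. j * m + i \<in> S \<longrightarrow> y ! i = block m j x ! i"
      "h y \<noteq> h (block m j x)"
      by (auto simp: is_certificate_def)
    then show ?thesis using False that by auto
  qed
  then obtain Y where Y: "\<And>j. j < n \<Longrightarrow> Y j \<in> cube m"
    "\<And>j i. j < n \<Longrightarrow> i < m \<Longrightarrow> j * m + i \<in> S \<Longrightarrow> Y j ! i = block m j x ! i"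
    "\<And>j. j < n \<Longrightarrow> h (Y j) = z ! j"
    by metis
  have "glue n m Y ! k = x ! k" if "k \<in> S" for k
  proof -
    have "k < n * m" using S that by (auto simp: is_certificate_def)
    then have km: "k div m < n" "k mod m < m"
      by (auto simp: less_mult_imp_div_less intro!: mod_less_divisor gr0I)
    show ?thesis
      using glue_nth[OF km, of Y] Y(2)[OF km] block_nth[OF x km] that by simp
  qed
  then have "block_compose n m f h (glue n m Y) = block_compose n m f h x"
    using certificateD[OF S glue_in_cube] by blast
  moreover have "map (\<lambda>j. h (Y j)) [0..<n] = z"
    using z Y by (intro nth_equalityI) (auto simp: cube_def)
  ultimately show "f z = f ?z"
    using Y(1) by (simp add: block_compose_glue) (simp add: block_compose_def)
qed

section \<open>Certificates of \<open>g1\<close> and the upper bound for the family\<close>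

lemma ex_card: "\<exists>T\<subseteq>S. card T = n" if "n \<le> card S"
  using obtain_subset_with_card_n[OF that] by blast

text \<open>Thirteen fixed ones force weight at least 13 and thirteen fixed zeros force weight at
  most 29 - 13 = 16.\<close>

lemma g1_certificate_True:
  assumes z: "z \<in> cube 29" and "g1 z"
  obtains T where "is_certificate 29 g1 z T" "card {j\<in>T. z ! j} = 13" "card {j\<in>T. \<not> z ! j} = 13"
proof -
  have w: "13 \<le> weight 29 z" "weight 29 z \<le> 16" using assms g1_iff by auto
  have zeros: "13 \<le> card {j. j < 29 \<and> \<not> z ! j}" using w(2) card_zeros[of 29 z] by simp
  obtain P where P: "P \<subseteq> {j. j < 29 \<and> z ! j}" "card P = 13"
    using ex_card[OF w(1)[unfolded weight_def]] by blast
  obtain Q where Q: "Q \<subseteq> {j. j < 29 \<and> \<not> z ! j}" "card Q = 13"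
    using ex_card[OF zeros] by blast
  show thesis
  proof (rule that[of "P \<union> Q"])
    show "is_certificate 29 g1 z (P \<union> Q)"
      unfolding is_certificate_def
    proof (intro conjI ballI impI)
      show "P \<union> Q \<subseteq> {..<29}" using P Q by auto
      fix y assume y: "y \<in> cube 29" and agree: "\<forall>i\<in>P \<union> Q. y ! i = z ! i"
      have "P \<subseteq> {j. j < 29 \<and> y ! j}" "Q \<subseteq> {j. j < 29 \<and> \<not> y ! j}"
        using P Q agree by blast+
      then have "13 \<le> weight 29 y" "13 \<le> 29 - weight 29 y"
        using card_mono[of "{j. j < 29 \<and> y ! j}" P] card_mono[of "{j. j < 29 \<and> \<not> y ! j}" Q] P Q
        by (auto simp: weight_def card_zeros[unfolded weight_def])
      then show "g1 y = g1 z" using g1_iff[OF y] \<open>g1 z\<close> by auto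
    qed
    have "{j\<in>P \<union> Q. z ! j} = P" "{j\<in>P \<union> Q. \<not> z ! j} = Q" using P Q by auto
    then show "card {j\<in>P \<union> Q. z ! j} = 13" "card {j\<in>P \<union> Q. \<not> z ! j} = 13" using P Q by simp_all
  qed
qed

text \<open>Seventeen fixed ones put the weight above the window, and seventeen fixed zeros leave at
  most 12 ones. One of the two is available at every input of value 0.\<close>

lemma g1_certificate_False:
  assumes z: "z \<in> cube 29" and "\<not> g1 z"
  obtains T where "is_certificate 29 g1 z T" "card T = 17"
proof -
  consider "weight 29 z \<le> 12" | "weight 29 z \<ge> 17" using assms g1_iff by fastforce
  then obtain b where b: "17 \<le> card {j. j < 29 \<and> z ! j = b}"
  proof cases
    case 1
    then show thesis using that[of False] card_zeros[of 29 z] by simp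
  next
    case 2
    then show thesis using that[of True] by (simp add: weight_def)
  qed
  then obtain T where T: "T \<subseteq> {j. j < 29 \<and> z ! j = b}" "card T = 17"
    using ex_card[OF b] by blast
  show thesis
  proof (rule that[of T])
    show "is_certificate 29 g1 z T"
      unfolding is_certificate_def
    proof (intro conjI ballI impI)
      show "T \<subseteq> {..<29}" using T by auto
      fix y assume y: "y \<in> cube 29" and agree: "\<forall>i\<in>T. y ! i = z ! i"
      have "T \<subseteq> {j. j < 29 \<and> y ! j = b}" using T agree by blast
      then have "17 \<le> card {j. j < 29 \<and> y ! j = b}"
        using card_mono[of "{j. j < 29 \<and> y ! j = b}" T] T by auto
      then have "weight 29 y \<ge> 17 \<or> weight 29 y \<le> 12"
        using card_zeros[of 29 y] by (cases b) (auto simp: weight_def)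
      then show "g1 y = g1 z" using g1_iff[OF y] \<open>\<not> g1 z\<close> by auto
    qed
  qed (fact T)
qed

text \<open>The growth rate is the positive root of \<open>L\<^sup>2 = 13 L + 13 \<cdot> 17\<close>, the characteristic equation of
  \<open>C\<^sub>1(t + 1) = 13 C\<^sub>1(t) + 13 C\<^sub>0(t)\<close>, \<open>C\<^sub>0(t + 1) = 17 C\<^sub>1(t)\<close>.\<close>

definition L :: real where "L = (13 + sqrt 1053) / 2"

lemma L_square: "L * L = 13 * L + 221"
  by (simp add: L_def field_simps)

lemma L_ge: "L \<ge> 22"
proof -
  have "31 \<le> sqrt 1053" by (rule real_le_rsqrt) simp
  then show ?thesis by (simp add: L_def)
qed

text \<open>The solution of the recursion that is proportional to \<open>L ^ t\<close>, scaled so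
  that both components are at least 1 at \<open>t = 0\<close> but at most 1 after multiplication by
  \<open>17 / L\<close>. Thus it bounds the costs from above, and \<open>17 / L\<close> times it
  bounds them from below.\<close>

definition cert_growth :: "nat \<Rightarrow> bool \<Rightarrow> real" where
  "cert_growth t b = (if b then L ^ Suc t / 17 else L ^ t)"

lemma cert_growth_Suc_True: "cert_growth (Suc t) True = 13 * cert_growth t True + 13 * cert_growth t False"
proof -
  have "L ^ Suc (Suc t) = (L * L) * L ^ t" by simp
  then show ?thesis by (simp add: cert_growth_def L_square field_simps)
qed

lemma cert_growth_Suc_False: "cert_growth (Suc t) False = 17 * cert_growth t True"
  by (simp add: cert_growth_def)

lemma cert_growth_le_True: "cert_growth t b \<le> cert_growth t True"
  using mult_right_mono[of 17 L "L ^ t"] L_ge by (auto simp: cert_growth_def field_simps)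

lemma G_certificate_upper:
  "\<lbrakk>x \<in> cube (29 ^ t); G t x = b\<rbrakk> \<Longrightarrow> \<exists>S. is_certificate (29 ^ t) (G t) x S \<and> real (card S) \<le> cert_growth t b"
proof (induction t arbitrary: x b)
  case 0
  have "cert_growth 0 b \<ge> 1" using L_ge by (auto simp: cert_growth_def)
  then show ?case by (intro exI[of _ "{0}"]) (auto simp: is_certificate_def)
next
  case (Suc t)
  let ?m = "29 ^ t"
  let ?z = "map (\<lambda>j. G t (block ?m j x)) [0..<29]"
  have x: "x \<in> cube (29 * ?m)" using Suc by simp
  have "\<exists>S. is_certificate ?m (G t) (block ?m j x) S \<and> real (card S) \<le> cert_growth t (?z ! j)"
    if "j < 29" for j
    using Suc.IH[OF block_in_cube[OF x that] refl] that by simp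
  then obtain S where S: "\<And>j. j < 29 \<Longrightarrow> is_certificate ?m (G t) (block ?m j x) (S j)"
    "\<And>j. j < 29 \<Longrightarrow> real (card (S j)) \<le> cert_growth t (?z ! j)"
    by metis
  have gz: "g1 ?z = b" using Suc.prems by (simp add: block_compose_def)
  have main: ?case if T: "is_certificate 29 g1 ?z T"
    and le: "(\<Sum>j\<in>T. cert_growth t (?z ! j)) \<le> cert_growth (Suc t) b" for T
  proof -
    let ?U = "\<Union>j\<in>T. (\<lambda>i. j * ?m + i) ` S j"
    have sub: "T \<subseteq> {..<29}" using T by (simp add: is_certificate_def)
    then have fin: "finite T" by (rule finite_subset) simp
    have "is_certificate (29 * ?m) (block_compose 29 ?m g1 (G t)) x ?U"
      using S(1) sub by (intro compose_certificateI x T) auto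
    moreover have "real (card ?U) \<le> cert_growth (Suc t) b"
    proof -
      have "finite (S j)" if "j \<in> T" for j
        using S(1)[of j] that sub finite_subset[of "S j" "{..<?m}"] by (auto simp: is_certificate_def)
      then have "card ?U \<le> (\<Sum>j\<in>T. card (S j))"
        using fin by (intro order_trans[OF card_UN_le] sum_mono card_image_le) auto
      then have "real (card ?U) \<le> (\<Sum>j\<in>T. real (card (S j)))"
        by (simp flip: of_nat_sum)
      also have "\<dots> \<le> (\<Sum>j\<in>T. cert_growth t (?z ! j))"
        using S(2) sub by (intro sum_mono) auto
      finally show ?thesis using le by simp
    qed
    ultimately show ?thesis by auto
  qed
  show ?case
  proof (cases b)
    case True
    then obtain T where T: "is_certificate 29 g1 ?z T" "card {j\<in>T. ?z ! j} = 13" "card {j\<in>T. \<not> ?z ! j} = 13"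
      using g1_certificate_True[of ?z] gz by auto
    have "finite T" using T(1) finite_subset[of T "{..<29}"] by (auto simp: is_certificate_def)
    then have "(\<Sum>j\<in>T. cert_growth t (?z ! j))
        = (\<Sum>j\<in>{j\<in>T. ?z ! j}. cert_growth t (?z ! j)) + (\<Sum>j\<in>{j\<in>T. \<not> ?z ! j}. cert_growth t (?z ! j))"
      by (subst sum.union_disjoint[symmetric]) (auto intro: sum.cong)
    also have "\<dots> = (\<Sum>j\<in>{j\<in>T. ?z ! j}. cert_growth t True) + (\<Sum>j\<in>{j\<in>T. \<not> ?z ! j}. cert_growth t False)"
      by (intro arg_cong2[of _ _ _ _ "(+)"] sum.cong) auto
    also have "\<dots> = cert_growth (Suc t) b"
      using T True by (simp add: cert_growth_Suc_True)
    finally show ?thesis using main[OF T(1)] by simp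
  next
    case False
    then obtain T where T: "is_certificate 29 g1 ?z T" "card T = 17"
      using g1_certificate_False[of ?z] gz by auto
    \<comment> \<open>The 17 chosen blocks may all have inner value 0; each is charged at the dearer
      value 1.\<close>
    have "(\<Sum>j\<in>T. cert_growth t (?z ! j)) \<le> (\<Sum>j\<in>T. cert_growth t True)"
      by (intro sum_mono cert_growth_le_True)
    then show ?thesis using main[OF T(1)] T False by (simp add: cert_growth_Suc_False)
  qed
qed

section \<open>Minimal certificates and the lower bound for the family\<close>

lemma finite_certificate: "finite S" if "is_certificate n f x S"
  using that finite_subset[of S "{..<n}"] by (auto simp: is_certificate_def)

lemma cert_at_le: "cert_at n f x \<le> card S" if "is_certificate n f x S"
  unfolding cert_at_def using that by (intro Least_le) auto

lemma cert_at_witness: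
  assumes "x \<in> cube n"
  obtains S where "is_certificate n f x S" "card S = cert_at n f x"
proof -
  have "is_certificate n f x {..<n}"
  proof (rule certificateI)
    show "f y = f x" if "y \<in> cube n" "\<And>i. i \<in> {..<n} \<Longrightarrow> y ! i = x ! i" for y
      using that assms nth_equalityI[of y x] by (simp add: cube_def)
  qed simp
  then have "\<exists>S. is_certificate n f x S \<and> card S = cert_at n f x"
    unfolding cert_at_def using LeastI[of "\<lambda>k. \<exists>S. is_certificate n f x S \<and> card S = k" "card {..<n}"] by blast
  then show thesis using that by blast
qed

lemma g1_pattern: "\<exists>z\<in>cube 29. weight 29 z = k" if "k \<le> 29"
proof -
  have "{j. j < 29 \<and> map (\<lambda>j. j < k) [0..<29] ! j} = {..<k}" using that by auto
  then have "weight 29 (map (\<lambda>j. j < k) [0..<29]) = k" by (simp add: weight_def)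
  then show ?thesis using cube_map_upt by blast
qed

lemma weight_flip:
  assumes "F \<subseteq> {j. j < n \<and> z ! j = b}"
  shows "weight n (map (\<lambda>j. if j \<in> F then \<not> b else z ! j) [0..<n])
    = (if b then weight n z - card F else weight n z + card F)"
proof (cases b)
  case True
  have fin: "finite F" using assms finite_subset[of F "{..<n}"] by auto
  have "{j. j < n \<and> map (\<lambda>j. if j \<in> F then \<not> b else z ! j) [0..<n] ! j} = {j. j < n \<and> z ! j} - F"
    using True by auto
  then show ?thesis using True assms fin by (simp add: weight_def card_Diff_subset)
next
  case False
  have fin: "finite F" using assms finite_subset[of F "{..<n}"] by auto
  have "{j. j < n \<and> map (\<lambda>j. if j \<in> F then \<not> b else z ! j) [0..<n] ! j} = {j. j < n \<and> z ! j} \<union> F"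
    using False assms by auto
  moreover have "{j. j < n \<and> z ! j} \<inter> F = {}" using False assms by auto
  ultimately show ?thesis using False fin by (simp add: weight_def card_Un_disjoint)
qed

text \<open>If \<open>k\<close> positions of value \<open>b\<close> were left free by
  \<open>T\<close>, flipping them would change \<open>g1\<close> without contradicting
  \<open>T\<close>.\<close>

lemma certificate_size:
  assumes z: "z \<in> cube 29" and T: "is_certificate 29 g1 z T"
    and flip: "\<And>y. \<lbrakk>y \<in> cube 29; weight 29 y = (if b then weight 29 z - k else weight 29 z + k)\<rbrakk>
      \<Longrightarrow> g1 y \<noteq> g1 z"
  shows "card {j\<in>{..<29}. z ! j = b} < card {j\<in>T. z ! j = b} + k"
proof (rule ccontr)
  assume *: "\<not> ?thesis"
  have sub: "{j\<in>T. z ! j = b} \<subseteq> {j\<in>{..<29}. z ! j = b}"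
    using T by (auto simp: is_certificate_def)
  have "card ({j\<in>{..<29}. z ! j = b} - {j\<in>T. z ! j = b}) \<ge> k"
    using * card_Diff_subset[OF finite_subset[OF sub] sub] by simp
  then obtain F where F: "F \<subseteq> {j\<in>{..<29}. z ! j = b} - {j\<in>T. z ! j = b}" "card F = k"
    using ex_card by blast
  let ?y = "map (\<lambda>j. if j \<in> F then \<not> b else z ! j) [0..<29]"
  have "weight 29 ?y = (if b then weight 29 z - k else weight 29 z + k)"
    using F by (subst weight_flip) auto
  moreover have "\<forall>i\<in>T. ?y ! i = z ! i"
  proof
    fix i assume "i \<in> T"
    then have "i < 29" "i \<notin> F" using T F by (auto simp: is_certificate_def)
    then show "?y ! i = z ! i" by simp
  qed
  ultimately show False
    using flip[of ?y] certificateD[OF T, of ?y] cube_map_upt by blast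
qed

lemma G_certificate_lower:
  "\<exists>x\<in>cube (29 ^ t). G t x = b \<and>
    (\<forall>S. is_certificate (29 ^ t) (G t) x S \<longrightarrow> 17 / L * cert_growth t b \<le> real (card S))"
proof (induction t arbitrary: b)
  case 0
  have "card S \<noteq> 0" if "is_certificate 1 (G 0) [b] S" for S
  proof
    assume "card S = 0"
    then have "S = {}" using finite_certificate[OF that] by simp
    then show False using certificateD[OF that, of "[\<not> b]"] by (simp add: cube_def)
  qed
  moreover have "17 / L * cert_growth 0 b \<le> 1" using L_ge by (auto simp: cert_growth_def)
  ultimately show ?case
    by (intro bexI[of _ "[b]"]) (fastforce simp: cube_def)+
next
  case (Suc t)
  let ?m = "29 ^ t"
  obtain X where X: "\<And>b. X b \<in> cube ?m" "\<And>b. G t (X b) = b"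
    "\<And>b S. is_certificate ?m (G t) (X b) S \<Longrightarrow> 17 / L * cert_growth t b \<le> real (card S)"
    using Suc.IH by metis
  \<comment> \<open>These weights sit at the edge of the window: for either value, losing a single
    one changes the value, so a certificate contains all the ones, which stand for the dearer
    blocks.\<close>
  have "(if b then 13 else 17) \<le> (29::nat)" by simp
  then obtain z where z: "z \<in> cube 29" "weight 29 z = (if b then 13 else 17)"
    using g1_pattern by blast
  let ?x = "glue 29 ?m (\<lambda>j. X (z ! j))"
  have x: "?x \<in> cube (29 * ?m)" by (rule glue_in_cube)
  have z_eq: "map (\<lambda>j. z ! j) [0..<29] = z"
    using z by (intro nth_equalityI) (auto simp: cube_def)
  have blk: "block ?m j ?x = X (z ! j)" if "j < 29" for j
    using X that by (simp add: block_glue)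
  have z_blk: "map (\<lambda>j. G t (block ?m j ?x)) [0..<29] = z"
    using blk X by (subst z_eq[symmetric]) (auto intro!: map_cong)
  have gz: "g1 z = b" using z g1_iff[of z] by auto
  have "17 / L * cert_growth (Suc t) b \<le> real (card S)"
    if S: "is_certificate (29 * ?m) (block_compose 29 ?m g1 (G t)) ?x S" for S
  proof -
    define R where "R j = {i. i < ?m \<and> j * ?m + i \<in> S}" for j
    define A where "A = {j. j < 29 \<and> is_certificate ?m (G t) (block ?m j ?x) (R j)}"
    have A: "is_certificate 29 g1 z A"
      using compose_certificateD[OF x S] unfolding z_blk A_def R_def .
    have finA: "finite A" by (simp add: A_def)
    have sum_le: "(\<Sum>j\<in>A. real (card (R j))) \<le> real (card S)"
    proof -
      have "(\<Sum>j\<in>A. card (R j)) = card (\<Union>j\<in>A. (\<lambda>i. j * ?m + i) ` R j)"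
      proof (subst card_UN_disjoint)
        show "\<forall>i\<in>A. \<forall>j\<in>A. i \<noteq> j \<longrightarrow> (\<lambda>k. i * ?m + k) ` R i \<inter> (\<lambda>k. j * ?m + k) ` R j = {}"
        proof (intro ballI impI equals0I)
          fix i j k assume "i \<noteq> j" "k \<in> (\<lambda>k. i * ?m + k) ` R i \<inter> (\<lambda>k. j * ?m + k) ` R j"
          then obtain a b where ab: "k = i * ?m + a" "a \<in> R i" "k = j * ?m + b" "b \<in> R j"
            by blast
          have "k div ?m = i" using ab(1,2) by (simp add: R_def)
          moreover have "k div ?m = j" using ab(3,4) by (simp add: R_def)
          ultimately show False using \<open>i \<noteq> j\<close> by simp
        qed
      qed (use finA in \<open>auto simp: R_def card_image\<close>)
      also have "\<dots> \<le> card S"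
        using finite_certificate[OF S] by (intro card_mono) (auto simp: R_def)
      finally show ?thesis by (simp flip: of_nat_sum)
    qed
    have "17 / L * cert_growth t (z ! j) \<le> real (card (R j))" if "j \<in> A" for j
      using that X(3)[of "z ! j" "R j"] blk by (auto simp: A_def)
    then have "(\<Sum>j\<in>A. 17 / L * cert_growth t (z ! j)) \<le> real (card S)"
      by (intro order_trans[OF _ sum_le] sum_mono)
    also have "(\<Sum>j\<in>A. 17 / L * cert_growth t (z ! j)) =
        real (card {j\<in>A. z ! j = True}) * (17 / L * cert_growth t True)
      + real (card {j\<in>A. z ! j = False}) * (17 / L * cert_growth t False)"
    proof -
      have "(\<Sum>j\<in>A. 17 / L * cert_growth t (z ! j)) =
          (\<Sum>j\<in>{j\<in>A. z ! j = True}. 17 / L * cert_growth t (z ! j))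
        + (\<Sum>j\<in>{j\<in>A. z ! j = False}. 17 / L * cert_growth t (z ! j))"
        using finA by (subst sum.union_disjoint[symmetric]) (auto intro: sum.cong)
      also have "\<dots> = (\<Sum>j\<in>{j\<in>A. z ! j = True}. 17 / L * cert_growth t True)
        + (\<Sum>j\<in>{j\<in>A. z ! j = False}. 17 / L * cert_growth t False)"
        by (intro arg_cong2[of _ _ _ _ "(+)"] sum.cong) auto
      finally show ?thesis by simp
    qed
    finally have bound: "real (card {j\<in>A. z ! j = True}) * (17 / L * cert_growth t True)
      + real (card {j\<in>A. z ! j = False}) * (17 / L * cert_growth t False) \<le> real (card S)" .
    have pos: "17 / L * cert_growth t b \<ge> 0" for b
      using L_ge by (auto simp: cert_growth_def)
    have ones: "card {j\<in>{..<29}. z ! j = True} = weight 29 z"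
      by (simp add: weight_def)
    have zeros: "card {j\<in>{..<29}. z ! j = False} = 29 - weight 29 z"
      using card_zeros[of 29 z] by simp
    show ?thesis
    proof (cases b)
      case True
      have "card {j\<in>{..<29}. z ! j = True} < card {j\<in>A. z ! j = True} + 1"
        using z A True g1_iff by (intro certificate_size) auto
      then have c1: "13 \<le> card {j\<in>A. z ! j = True}" using ones z True by simp
      \<comment> \<open>Four additional ones lead from weight 13 to 17, so at most 3 of the 16 zeros
        stay free.\<close>
      have "card {j\<in>{..<29}. z ! j = False} < card {j\<in>A. z ! j = False} + 4"
        using z A True g1_iff by (intro certificate_size) auto
      then have c2: "13 \<le> card {j\<in>A. z ! j = False}" using zeros z True by simp
      have "13 * (17 / L * cert_growth t True) + 13 * (17 / L * cert_growth t False) \<le> real (card S)"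
        using c1 c2 by (intro order_trans[OF _ bound] add_mono mult_right_mono pos) auto
      then show ?thesis using True by (simp add: cert_growth_Suc_True algebra_simps)
    next
      case False
      have "card {j\<in>{..<29}. z ! j = True} < card {j\<in>A. z ! j = True} + 1"
        using z A False g1_iff by (intro certificate_size) auto
      then have c1: "17 \<le> card {j\<in>A. z ! j = True}" using ones z False by simp
      \<comment> \<open>The summand 0 bounds the share of the zeros, which a certificate at weight
        17 may ignore.\<close>
      have "17 * (17 / L * cert_growth t True) + 0 \<le> real (card S)"
        using c1 by (intro order_trans[OF _ bound] add_mono mult_right_mono mult_nonneg_nonneg pos) auto
      then show ?thesis using False by (simp add: cert_growth_Suc_False)
    qed
  qed
  moreover have "block_compose 29 ?m g1 (G t) ?x = b"
    using z_blk gz by (simp add: block_compose_def)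
  ultimately show ?case using x by auto
qed

lemma cert_cong: "cert n f = cert n h" if "\<And>x. x \<in> cube n \<Longrightarrow> f x = h x"
proof -
  have "is_certificate n f x S = is_certificate n h x S" if "x \<in> cube n" for x S
    unfolding is_certificate_def using \<open>\<And>x. x \<in> cube n \<Longrightarrow> f x = h x\<close> that by (simp cong: ball_cong)
  then have "cert_at n f x = cert_at n h x" if "x \<in> cube n" for x
    using that by (simp add: cert_at_def)
  then show ?thesis unfolding cert_def by (simp cong: image_cong)
qed

lemma cert_G_upper: "real (cert (29 ^ t) (G t)) \<le> L * L ^ t"
proof -
  have "cert_at (29 ^ t) (G t) x \<le> L * L ^ t" if x: "x \<in> cube (29 ^ t)" for x
  proof -
    obtain S where S: "is_certificate (29 ^ t) (G t) x S" "real (card S) \<le> cert_growth t (G t x)"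
      using G_certificate_upper[OF x refl] by auto
    have "real (cert_at (29 ^ t) (G t) x) \<le> cert_growth t True"
      using cert_at_le[OF S(1)] S(2) cert_growth_le_True[of t "G t x"] by linarith
    also have "\<dots> \<le> L * L ^ t" using L_ge by (simp add: cert_growth_def)
    finally show ?thesis .
  qed
  moreover have "cert (29 ^ t) (G t) \<in> cert_at (29 ^ t) (G t) ` cube (29 ^ t)"
    unfolding cert_def using finite_cube cube_nonempty by (intro Max_in) auto
  ultimately show ?thesis by auto
qed

lemma cert_G_lower: "L ^ t \<le> real (cert (29 ^ t) (G t))"
proof -
  obtain x where x: "x \<in> cube (29 ^ t)"
    "\<And>S. is_certificate (29 ^ t) (G t) x S \<Longrightarrow> 17 / L * cert_growth t True \<le> real (card S)"
    using G_certificate_lower[of t True] by auto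
  obtain S where S: "is_certificate (29 ^ t) (G t) x S" "card S = cert_at (29 ^ t) (G t) x"
    using cert_at_witness[OF x(1)] .
  have "L ^ t = 17 / L * cert_growth t True" using L_ge by (simp add: cert_growth_def)
  also have "\<dots> \<le> real (cert_at (29 ^ t) (G t) x)" using x(2)[OF S(1)] S(2) by simp
  also have "\<dots> \<le> real (cert (29 ^ t) (G t))"
    unfolding cert_def using finite_cube x(1) by (simp add: Max_ge)
  finally show ?thesis .
qed

section \<open>Sensitive families and fractional certificates\<close>

text \<open>\<open>N\<close> disjoint sensitive blocks as in block sensitivity; block
  \<open>k\<close> is the set of positions where \<open>Y k\<close> differs from \<open>x\<close>.
  Storing whole inputs instead of sets lets families be composed by gluing.\<close>

definition sensitive_family ::
  "nat \<Rightarrow> (bool list \<Rightarrow> bool) \<Rightarrow> bool list \<Rightarrow> nat \<Rightarrow> (nat \<Rightarrow> bool list) \<Rightarrow> bool" where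
  "sensitive_family n f x N Y \<longleftrightarrow>
     (\<forall>k<N. Y k \<in> cube n \<and> f (Y k) \<noteq> f x) \<and>
     (\<forall>i<n. \<forall>k<N. \<forall>l<N. Y k ! i \<noteq> x ! i \<longrightarrow> Y l ! i \<noteq> x ! i \<longrightarrow> k = l)"

text \<open>The index \<open>k\<close> encodes a pair: \<open>k div N\<close> selects an outer
  block, \<open>k mod N\<close> an inner one, which is flipped in every component of that outer
  block. A changed position determines both parts of the pair, whence disjointness. A family is
  required for each \<open>b\<close> since the flipped components can have either value.\<close>

lemma compose_sensitive_family:
  assumes z: "z \<in> cube n" and Z: "sensitive_family n f z M Z"
    and X: "\<And>b. X b \<in> cube m" "\<And>b. h (X b) = b"
    and Y: "\<And>b. sensitive_family m h (X b) N (Y b)"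
  shows "sensitive_family (n * m) (block_compose n m f h) (glue n m (\<lambda>j. X (z ! j))) (M * N)
    (\<lambda>k. glue n m (\<lambda>j. if Z (k div N) ! j \<noteq> z ! j then Y (z ! j) (k mod N) else X (z ! j)))"
    (is "sensitive_family _ _ ?x _ ?W")
  unfolding sensitive_family_def
proof (intro conjI allI impI)
  have idx: "k div N < M" "k mod N < N" if "k < M * N" for k
    using that by (auto simp: less_mult_imp_div_less intro!: mod_less_divisor gr0I)
  have z_eq: "map (\<lambda>j. z ! j) [0..<n] = z"
    using z by (intro nth_equalityI) (auto simp: cube_def)
  fix k assume k: "k < M * N"
  note k' = idx[OF k]
  show "?W k \<in> cube (n * m)" by (rule glue_in_cube)
  have Zk: "Z (k div N) \<in> cube n" "f (Z (k div N)) \<noteq> f z"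
    using Z k' by (auto simp: sensitive_family_def)
  have Yk: "Y b (k mod N) \<in> cube m" "h (Y b (k mod N)) = (\<not> b)" for b
    using Y[of b] k' X(2)[of b] by (auto simp: sensitive_family_def)
  have "map (\<lambda>j. h (if Z (k div N) ! j \<noteq> z ! j then Y (z ! j) (k mod N) else X (z ! j))) [0..<n] = Z (k div N)"
    using Zk X Yk by (intro nth_equalityI) (auto simp: cube_def)
  then have "block_compose n m f h (?W k) = f (Z (k div N))"
    using X Yk by (subst block_compose_glue) auto
  moreover have "block_compose n m f h ?x = f z"
    using X z_eq by (subst block_compose_glue) auto
  ultimately show "block_compose n m f h (?W k) \<noteq> block_compose n m f h ?x"
    using Zk by simp
next
  fix i k l assume i: "i < n * m" and k: "k < M * N" and l: "l < M * N"
    and ne: "?W k ! i \<noteq> ?x ! i" "?W l ! i \<noteq> ?x ! i"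
  have idx: "k div N < M" "k mod N < N" if "k < M * N" for k
    using that by (auto simp: less_mult_imp_div_less intro!: mod_less_divisor gr0I)
  have i': "i div m < n" "i mod m < m"
    using i by (auto simp: less_mult_imp_div_less intro!: mod_less_divisor gr0I)
  have glue_i: "glue n m B ! i = B (i div m) ! (i mod m)" for B
    using glue_nth[OF i', of B] by simp
  have d: "Z (k div N) ! (i div m) \<noteq> z ! (i div m)
      \<and> Y (z ! (i div m)) (k mod N) ! (i mod m) \<noteq> X (z ! (i div m)) ! (i mod m)"
    if "?W k ! i \<noteq> ?x ! i" for k
    using that unfolding glue_i by (auto split: if_splits)
  have "k div N = l div N"
    using Z d[OF ne(1)] d[OF ne(2)] i'(1) idx(1)[OF k] idx(1)[OF l] unfolding sensitive_family_def by blast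
  moreover have "k mod N = l mod N"
    using Y d[OF ne(1)] d[OF ne(2)] i'(2) idx(2)[OF k] idx(2)[OF l] unfolding sensitive_family_def by blast
  ultimately show "k = l" by (metis div_mult_mod_eq)
qed

text \<open>\<open>B j\<close> is the number of the block containing \<open>j\<close>. Each position
  has one number, so the blocks are disjoint; a number outside \<open>0, ..., N - 1\<close> marks a
  position that is never flipped.\<close>

lemma sensitive_family_flip:
  assumes "\<And>k. k < N \<Longrightarrow> f (map (\<lambda>j. p j \<noteq> (B j = k)) [0..<n]) \<noteq> f (map p [0..<n])"
  shows "sensitive_family n f (map p [0..<n]) N (\<lambda>k. map (\<lambda>j. p j \<noteq> (B j = k)) [0..<n])"
  using assms by (auto simp: sensitive_family_def)

text \<open>For the value 1, the weight is 13 and the 17 disjoint sensitive blocks are the 13 single ones and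
  4 blocks of 4 zeros; for the value 0, the weight is 12 and the blocks are the 17 single zeros.\<close>

lemma g1_sensitive_family: "\<exists>z\<in>cube 29. g1 z = b \<and> (\<exists>Z. sensitive_family 29 g1 z 17 Z)"
proof (cases b)
  case True
  have "list_all (\<lambda>k. \<not> g1 (map (\<lambda>j. (j < 13) \<noteq> ((if j < 13 then j else 13 + (j - 13) div 4) = k)) [0..<29]))
      [0..<17]"
    by code_simp
  moreover have "g1 (map (\<lambda>j. j < 13) [0..<29])" by code_simp
  ultimately show ?thesis
    using True sensitive_family_flip[of 17 g1 "\<lambda>j. j < 13" "\<lambda>j. if j < 13 then j else 13 + (j - 13) div 4" 29]
    by (fastforce simp: list_all_iff)
next
  case False
  have "list_all (\<lambda>k. g1 (map (\<lambda>j. (j < 12) \<noteq> ((if j < 12 then 17 else j - 12) = k)) [0..<29])) [0..<17]"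
    by code_simp
  moreover have "\<not> g1 (map (\<lambda>j. j < 12) [0..<29])" by code_simp
  ultimately show ?thesis
    using False sensitive_family_flip[of 17 g1 "\<lambda>j. j < 12" "\<lambda>j. if j < 12 then 17 else j - 12" 29]
    by (fastforce simp: list_all_iff)
qed

lemma G_sensitive_family:
  "\<exists>x\<in>cube (29 ^ t). G t x = b \<and> (\<exists>Y. sensitive_family (29 ^ t) (G t) x (17 ^ t) Y)"
proof (induction t arbitrary: b)
  case 0
  have "sensitive_family 1 (G 0) [b] 1 (\<lambda>_. [\<not> b])"
    by (auto simp: sensitive_family_def cube_def)
  then show ?case by (intro bexI[of _ "[b]"]) (auto simp: cube_def)
next
  case (Suc t)
  obtain X Y where X: "\<And>b. X b \<in> cube (29 ^ t)" "\<And>b. G t (X b) = b"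
    and Y: "\<And>b. sensitive_family (29 ^ t) (G t) (X b) (17 ^ t) (Y b)"
    using Suc.IH by metis
  obtain z Z where z: "z \<in> cube 29" "g1 z = b" and Z: "sensitive_family 29 g1 z 17 Z"
    using g1_sensitive_family by metis
  let ?x = "glue 29 (29 ^ t) (\<lambda>j. X (z ! j))"
  have "map (\<lambda>j. G t (X (z ! j))) [0..<29] = z"
    using z X by (intro nth_equalityI) (auto simp: cube_def)
  then have "G (Suc t) ?x = b"
    using X z by (simp add: block_compose_glue)
  then show ?case
    using compose_sensitive_family[OF z(1) Z X Y] glue_in_cube[of 29 "29 ^ t"] by auto
qed

section \<open>Fractional certificates, the linear relaxation of certificates\<close>

definition fractional_certificate ::
  "nat \<Rightarrow> (bool list \<Rightarrow> bool) \<Rightarrow> bool list \<Rightarrow> (nat \<Rightarrow> real) \<Rightarrow> bool" where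
  "fractional_certificate n f x w \<longleftrightarrow>
     (\<forall>i. 0 \<le> w i) \<and> (\<forall>y\<in>cube n. f y \<noteq> f x \<longrightarrow> 1 \<le> (\<Sum>i<n. w i * of_bool (y ! i \<noteq> x ! i)))"

lemma sum_mult_index: "(\<Sum>k<n * m. F k) = (\<Sum>j<n. \<Sum>i<m. F (j * m + i :: nat))"
  for F :: "nat \<Rightarrow> 'a :: comm_monoid_add"
proof -
  have "sum F {j * m..<j * m + m} = (\<Sum>i<m. F (j * m + i))" for j
    by (rule sum.reindex_bij_witness[of _ "\<lambda>i. j * m + i" "\<lambda>i. i - j * m"]) auto
  then show ?thesis by (simp add: sum.nat_group[symmetric])
qed

text \<open>Product weights work: wherever the outer bit changes, the inner disagreement has weight
  at least 1, so the outer inequality survives when each indicator is replaced by its inner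
  sum.\<close>

lemma compose_fractional_certificate:
  assumes x: "x \<in> cube (n * m)"
    and v: "fractional_certificate n f (map (\<lambda>j. h (block m j x)) [0..<n]) v"
    and u: "\<And>j. j < n \<Longrightarrow> fractional_certificate m h (block m j x) (u j)"
  shows "fractional_certificate (n * m) (block_compose n m f h) x
    (\<lambda>k. if k < n * m then v (k div m) * u (k div m) (k mod m) else 0)"
    (is "fractional_certificate _ _ _ ?w")
  unfolding fractional_certificate_def
proof (intro conjI ballI impI allI)
  have v0: "0 \<le> v j" for j using v by (auto simp: fractional_certificate_def)
  have u0: "0 \<le> u j i" if "j < n" for i j using u[OF that] by (auto simp: fractional_certificate_def)
  show "0 \<le> ?w k" for k
    using v0 u0 by (auto simp: less_mult_imp_div_less)
  fix y assume y: "y \<in> cube (n * m)" and ne: "block_compose n m f h y \<noteq> block_compose n m f h x"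
  let ?zx = "map (\<lambda>j. h (block m j x)) [0..<n]" and ?zy = "map (\<lambda>j. h (block m j y)) [0..<n]"
  have "1 \<le> (\<Sum>j<n. v j * of_bool (?zy ! j \<noteq> ?zx ! j))"
    using v ne cube_map_upt unfolding fractional_certificate_def block_compose_def by blast
  also have "\<dots> \<le> (\<Sum>j<n. v j * (\<Sum>i<m. u j i * of_bool (y ! (j * m + i) \<noteq> x ! (j * m + i))))"
  proof (intro sum_mono mult_left_mono v0)
    fix j assume "j \<in> {..<n}"
    then have j: "j < n" by simp
    have "of_bool (h (block m j y) \<noteq> h (block m j x)) \<le> (\<Sum>i<m. u j i * of_bool (block m j y ! i \<noteq> block m j x ! i))"
      using u[OF j] block_in_cube[OF y j] u0[OF j]
      by (auto simp: fractional_certificate_def intro: sum_nonneg)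
    then show "of_bool (?zy ! j \<noteq> ?zx ! j) \<le> (\<Sum>i<m. u j i * of_bool (y ! (j * m + i) \<noteq> x ! (j * m + i)))"
      using j by (simp add: block_nth[OF x j] block_nth[OF y j])
  qed
  also have "\<dots> = (\<Sum>k<n * m. ?w k * of_bool (y ! k \<noteq> x ! k))"
    unfolding sum_mult_index sum_distrib_left
    by (intro sum.cong refl) (auto simp: mult_add_less mult.assoc)
  finally show "1 \<le> (\<Sum>k<n * m. ?w k * of_bool (y ! k \<noteq> x ! k))" .
qed

lemma weight_sum: "real (weight n x) = (\<Sum>i<n. of_bool (x ! i))"
proof -
  have "{j. j < n \<and> x ! j} = {..<n} \<inter> {j. x ! j}" by auto
  then show ?thesis by (simp add: weight_def of_bool_def sum.If_cases)
qed

text \<open>By symmetry it suffices to give all ones a common weight \<open>a\<close> and all zeros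
  a common weight \<open>b\<close>. Each is the reciprocal of the number of such bits that must flip
  to change the value, or 0 if flips of that kind alone cannot change it.\<close>

lemma g1_fractional_certificate:
  assumes z: "z \<in> cube 29"
  shows "\<exists>w. fractional_certificate 29 g1 z w \<and> (\<Sum>i<29. w i) \<le> 17"
proof -
  define s where "s = real (weight 29 z)"
  have s29: "s \<le> 29" using weight_le[of 29 z] by (simp add: s_def)
  obtain a b where ab: "0 \<le> a" "0 \<le> b" "a * s + b * (29 - s) \<le> 17"
    "\<And>y. \<lbrakk>y \<in> cube 29; g1 y \<noteq> g1 z\<rbrakk> \<Longrightarrow>
      1 \<le> a * (s - real (weight 29 y)) \<or> 1 \<le> b * (real (weight 29 y) - s)"
  proof -
    consider "weight 29 z \<le> 12" | "weight 29 z \<ge> 17"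
      | "weight 29 z = 13 \<or> weight 29 z = 14 \<or> weight 29 z = 15 \<or> weight 29 z = 16" by linarith
    then show thesis
    proof cases
      case 1
      then have "s \<le> 12" by (simp add: s_def)
      moreover have "13 \<le> real (weight 29 y)" if "y \<in> cube 29" "g1 y \<noteq> g1 z" for y
        using that g1_iff[of y] g1_iff[OF z] 1 by auto
      ultimately show thesis
        by (intro that[of 0 "1 / (13 - s)"]) (auto simp: field_simps)
    next
      case 2
      then have "s \<ge> 17" by (simp add: s_def)
      moreover have "real (weight 29 y) \<le> 16" if "y \<in> cube 29" "g1 y \<noteq> g1 z" for y
        using that g1_iff[of y] g1_iff[OF z] 2 by auto
      ultimately show thesis
        by (intro that[of "1 / (s - 16)" 0]) (auto simp: field_simps)
    next
      case 3
      then have s: "s = 13 \<or> s = 14 \<or> s = 15 \<or> s = 16" by (auto simp: s_def)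
      moreover have "1 \<le> 1 / (s - 12) * (s - real (weight 29 y)) \<or> 1 \<le> 1 / (17 - s) * (real (weight 29 y) - s)"
        if y: "y \<in> cube 29" "g1 y \<noteq> g1 z" for y
      proof -
        have "weight 29 y \<le> 12 \<or> 17 \<le> weight 29 y"
          using y g1_iff[of y] g1_iff[OF z] 3 by force
        then have "real (weight 29 y) \<le> 12 \<or> 17 \<le> real (weight 29 y)" by auto
        then show ?thesis using s by (auto simp: field_simps)
      qed
      \<comment> \<open>The total weight \<open>s / (s - 12) + (29 - s) / (17 - s)\<close> is 17,
        12, 12, 17 for \<open>s\<close> = 13, 14, 15, 16.\<close>
      ultimately show thesis
        by (intro that[of "1 / (s - 12)" "1 / (17 - s)"]) auto
    qed
  qed
  define w where "w i = (if i < 29 then if z ! i then a else b else 0)" for i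
  have "(\<Sum>i<29. w i) = (\<Sum>i<29. a * of_bool (z ! i) + b * (1 - of_bool (z ! i)))"
    by (intro sum.cong) (auto simp: w_def)
  also have "\<dots> = a * s + b * (29 - s)"
    unfolding sum.distrib sum_distrib_left[symmetric] sum_subtractf s_def weight_sum by simp
  finally have "(\<Sum>i<29. w i) \<le> 17" using ab(3) by simp
  moreover have "fractional_certificate 29 g1 z w"
    unfolding fractional_certificate_def
  proof (intro conjI ballI impI allI)
    show "0 \<le> w i" for i using ab by (simp add: w_def)
    fix y assume "y \<in> cube 29" "g1 y \<noteq> g1 z"
    from ab(4)[OF this] show "1 \<le> (\<Sum>i<29. w i * of_bool (y ! i \<noteq> z ! i))"
    proof
      assume "1 \<le> a * (s - real (weight 29 y))"
      also have "\<dots> = (\<Sum>i<29. a * (of_bool (z ! i) - of_bool (y ! i)))"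
        by (simp only: s_def weight_sum sum_subtractf sum_distrib_left[symmetric])
      \<comment> \<open>The drop in weight is at most the number of ones lost, and each lost one is
        a disagreement of weight \<open>a\<close>.\<close>
      also have "\<dots> \<le> (\<Sum>i<29. w i * of_bool (y ! i \<noteq> z ! i))"
        using ab by (intro sum_mono) (auto simp: w_def)
      finally show ?thesis .
    next
      assume "1 \<le> b * (real (weight 29 y) - s)"
      also have "\<dots> = (\<Sum>i<29. b * (of_bool (y ! i) - of_bool (z ! i)))"
        by (simp only: s_def weight_sum sum_subtractf sum_distrib_left[symmetric])
      also have "\<dots> \<le> (\<Sum>i<29. w i * of_bool (y ! i \<noteq> z ! i))"
        using ab by (intro sum_mono) (auto simp: w_def)
      finally show ?thesis .
    qed
  qed
  ultimately show ?thesis by blast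
qed

lemma G_fractional_certificate:
  "x \<in> cube (29 ^ t) \<Longrightarrow> \<exists>w. fractional_certificate (29 ^ t) (G t) x w \<and> (\<Sum>i<29 ^ t. w i) \<le> 17 ^ t"
proof (induction t arbitrary: x)
  case 0
  then show ?case
    by (intro exI[of _ "\<lambda>_. 1"]) (auto simp: fractional_certificate_def)
next
  case (Suc t)
  let ?m = "29 ^ t"
  have x: "x \<in> cube (29 * ?m)" using Suc.prems by simp
  obtain v where v: "fractional_certificate 29 g1 (map (\<lambda>j. G t (block ?m j x)) [0..<29]) v" "(\<Sum>i<29. v i) \<le> 17"
    using g1_fractional_certificate[OF cube_map_upt] by blast
  obtain u where u: "\<And>j. j < 29 \<Longrightarrow> fractional_certificate ?m (G t) (block ?m j x) (u j)"
    "\<And>j. j < 29 \<Longrightarrow> (\<Sum>i<?m. u j i) \<le> 17 ^ t"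
    using Suc.IH[OF block_in_cube[OF x]] by metis
  let ?w = "\<lambda>k. if k < 29 * ?m then v (k div ?m) * u (k div ?m) (k mod ?m) else 0"
  have v0: "0 \<le> v j" for j using v by (auto simp: fractional_certificate_def)
  have "(\<Sum>k<29 * ?m. ?w k) = (\<Sum>j<29. v j * (\<Sum>i<?m. u j i))"
    unfolding sum_mult_index sum_distrib_left by (intro sum.cong refl) (auto simp: mult_add_less)
  also have "\<dots> \<le> (\<Sum>j<29. v j * 17 ^ t)"
    by (intro sum_mono mult_left_mono v0 u) auto
  also have "\<dots> \<le> 17 * 17 ^ t"
    unfolding sum_distrib_right[symmetric] by (intro mult_right_mono v) auto
  finally have "(\<Sum>k<29 * ?m. ?w k) \<le> 17 ^ Suc t" by simp
  moreover have "fractional_certificate (29 * ?m) (G (Suc t)) x ?w"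
    unfolding G.simps by (intro compose_fractional_certificate x v u)
  ultimately show ?case by auto
qed

section \<open>Queries and unitaries\<close>

definition query_pos :: "nat \<Rightarrow> nat \<Rightarrow> nat" where "query_pos w r = r div w div 2"
definition answer_bit :: "nat \<Rightarrow> nat \<Rightarrow> bool" where "answer_bit w r = odd (r div w)"

lemma basis_index_decomp: "basis_index w (query_pos w r) (answer_bit w r) (r mod w) = r"
proof -
  have "2 * (r div w div 2) + of_bool (odd (r div w)) = r div w"
    by (simp add: mod_2_eq_odd[symmetric])
  then show ?thesis by (simp add: basis_index_def query_pos_def answer_bit_def)
qed

lemma
  assumes "z < w"
  shows query_pos_basis_index [simp]: "query_pos w (basis_index w i b z) = i"
    and answer_bit_basis_index [simp]: "answer_bit w (basis_index w i b z) = b"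
    and mod_basis_index [simp]: "basis_index w i b z mod w = z"
  using assms by (auto simp: query_pos_def answer_bit_def basis_index_def)

lemma query_pos_less: "r < state_dim n w \<Longrightarrow> query_pos w r < n"
  by (simp add: query_pos_def state_dim_def less_mult_imp_div_less)

lemma workspace_pos: "r < state_dim n w \<Longrightarrow> 0 < w"
  by (auto simp: state_dim_def intro: gr0I)

lemma basis_index_less: "basis_index w i b z < state_dim n w" if "i < n" "z < w"
  unfolding basis_index_def state_dim_def using that by (intro mult_add_less) auto

text \<open>The query is the permutation matrix of this involution; hence applying it to a vector is
  a reindexing of the entries, and sums over all basis states are unchanged.\<close>

definition query_index :: "nat \<Rightarrow> bool list \<Rightarrow> nat \<Rightarrow> nat" where
  "query_index w y r = basis_index w (query_pos w r) (answer_bit w r \<noteq> y ! query_pos w r) (r mod w)"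

lemma query_index_less: "r < state_dim n w \<Longrightarrow> query_index w y r < state_dim n w"
  unfolding query_index_def by (intro basis_index_less query_pos_less) (auto dest: workspace_pos)

lemma query_pos_query_index: "0 < w \<Longrightarrow> query_pos w (query_index w y r) = query_pos w r"
  by (simp add: query_index_def)

lemma query_index_involution: "query_index w y (query_index w y r) = r" if "0 < w"
proof -
  have "((answer_bit w r \<noteq> y ! query_pos w r) \<noteq> y ! query_pos w r) = answer_bit w r" by blast
  then show ?thesis using that by (simp add: query_index_def basis_index_decomp)
qed

lemma query_mat_index: "query_mat n w y $$ (r, c) = of_bool (c = query_index w y r)"
  if "r < state_dim n w" "c < state_dim n w"
proof -
  have w: "0 < w" using workspace_pos[OF that(1)] .
  have "(\<exists>i<n. \<exists>b. \<exists>z<w. c = basis_index w i b z \<and> r = basis_index w i (b \<noteq> y ! i) z)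
      \<longleftrightarrow> c = query_index w y r"
  proof
    assume "\<exists>i<n. \<exists>b. \<exists>z<w. c = basis_index w i b z \<and> r = basis_index w i (b \<noteq> y ! i) z"
    then obtain i b z where c: "c = basis_index w i b z" "r = basis_index w i (b \<noteq> y ! i) z" "z < w"
      by blast
    have "((b \<noteq> y ! i) \<noteq> y ! i) = b" by blast
    then show "c = query_index w y r" using c by (simp add: query_index_def)
  next
    assume c: "c = query_index w y r"
    have "((answer_bit w r \<noteq> y ! query_pos w r) \<noteq> y ! query_pos w r) = answer_bit w r" by blast
    then have "r = basis_index w (query_pos w r) ((answer_bit w r \<noteq> y ! query_pos w r) \<noteq> y ! query_pos w r) (r mod w)"
      by (simp add: basis_index_decomp)
    then show "\<exists>i<n. \<exists>b. \<exists>z<w. c = basis_index w i b z \<and> r = basis_index w i (b \<noteq> y ! i) z"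
      using c query_pos_less[OF that(1)] mod_less_divisor[OF w] unfolding query_index_def by blast
  qed
  then show ?thesis using that by (simp add: query_mat_def)
qed

lemma mult_mat_vec_index: "(U *\<^sub>v v) $ r = (\<Sum>c<d. U $$ (r, c) * v $ c)"
  if "U \<in> carrier_mat k d" "v \<in> carrier_vec d" "r < k"
  using that by (auto simp: scalar_prod_def lessThan_atLeast0 intro!: sum.cong)

lemma query_mat_carrier: "query_mat n w y \<in> carrier_mat (state_dim n w) (state_dim n w)"
  by (simp add: query_mat_def)

lemma query_mat_vec_index: "(query_mat n w y *\<^sub>v v) $ r = v $ query_index w y r"
  if "v \<in> carrier_vec (state_dim n w)" "r < state_dim n w"
proof -
  have "(query_mat n w y *\<^sub>v v) $ r = (\<Sum>c<state_dim n w. of_bool (c = query_index w y r) * v $ c)"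
    using that by (simp add: mult_mat_vec_index[OF query_mat_carrier] query_mat_index)
  also have "\<dots> = (\<Sum>c<state_dim n w. if c = query_index w y r then v $ c else 0)"
    by (intro sum.cong) auto
  finally show ?thesis using query_index_less[OF that(2)] by simp
qed

lemma query_index_sum: "(\<Sum>r<state_dim n w. F (query_index w y r)) = (\<Sum>r<state_dim n w. F r)"
  for F :: "nat \<Rightarrow> 'a :: comm_monoid_add"
  by (rule sum.reindex_bij_witness[of _ "query_index w y" "query_index w y"])
    (auto simp: query_index_less query_index_involution dest: workspace_pos)

lemma unitary_mat_iff: "unitary_mat d U \<longleftrightarrow>
  U \<in> carrier_mat d d \<and> (\<forall>c<d. \<forall>c'<d. (\<Sum>r<d. cnj (U $$ (r, c)) * U $$ (r, c')) = of_bool (c = c'))"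
proof (cases "U \<in> carrier_mat d d")
  case True
  have adj: "mat_adjoint U \<in> carrier_mat d d"
    using True mat_of_rows_carrier(1)[of d "map conjugate (cols U)"] by (simp add: mat_adjoint_def)
  have "(mat_adjoint U * U) $$ (c, c') = (\<Sum>r<d. cnj (U $$ (r, c)) * U $$ (r, c'))" if "c < d" "c' < d" for c c'
    using that True adj
    by (auto simp: scalar_prod_def mat_adjoint_def mat_of_rows_def lessThan_atLeast0 intro!: sum.cong)
  then have "mat_adjoint U * U = 1\<^sub>m d \<longleftrightarrow>
      (\<forall>c<d. \<forall>c'<d. (\<Sum>r<d. cnj (U $$ (r, c)) * U $$ (r, c')) = of_bool (c = c'))"
    using True adj by (auto simp: mat_eq_iff of_bool_def)
  then show ?thesis using True by (simp add: unitary_mat_def)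
qed (simp add: unitary_mat_def)

lemma unitary_mat_carrier: "unitary_mat d U \<Longrightarrow> U \<in> carrier_mat d d"
  by (simp add: unitary_mat_def)

lemma query_mat_unitary: "unitary_mat (state_dim n w) (query_mat n w y)"
  unfolding unitary_mat_iff
proof (intro conjI allI impI query_mat_carrier)
  fix c c' assume c: "c < state_dim n w" "c' < state_dim n w"
  let ?F = "\<lambda>r. if c = r then of_bool (c' = r) else 0 :: complex"
  have "(\<Sum>r<state_dim n w. cnj (query_mat n w y $$ (r, c)) * query_mat n w y $$ (r, c'))
      = (\<Sum>r<state_dim n w. ?F (query_index w y r))"
    using c by (intro sum.cong refl) (simp add: query_mat_index)
  also have "\<dots> = of_bool (c = c')"
    unfolding query_index_sum[of ?F] using c by auto
  finally show "(\<Sum>r<state_dim n w. cnj (query_mat n w y $$ (r, c)) * query_mat n w y $$ (r, c'))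
      = of_bool (c = c')" .
qed

section \<open>Euclidean norm and its invariance under unitaries\<close>

definition vec_norm :: "nat \<Rightarrow> complex vec \<Rightarrow> real" where
  "vec_norm d v = L2_set (\<lambda>k. cmod (v $ k)) {..<d}"

lemma vec_norm_square: "(vec_norm d v)\<^sup>2 = (\<Sum>k<d. (cmod (v $ k))\<^sup>2)"
  by (simp add: vec_norm_def L2_set_def sum_nonneg)

lemma unitary_mat_inner:
  assumes U: "unitary_mat d U" and uv: "u \<in> carrier_vec d" "v \<in> carrier_vec d"
  shows "(\<Sum>k<d. cnj ((U *\<^sub>v u) $ k) * (U *\<^sub>v v) $ k) = (\<Sum>k<d. cnj (u $ k) * v $ k)"
proof -
  have cU: "U \<in> carrier_mat d d" using U by (rule unitary_mat_carrier)
  have "(\<Sum>k<d. cnj ((U *\<^sub>v u) $ k) * (U *\<^sub>v v) $ k)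
      = (\<Sum>k<d. \<Sum>c<d. \<Sum>c'<d. cnj (u $ c) * v $ c' * (cnj (U $$ (k, c)) * U $$ (k, c')))"
    using mult_mat_vec_index[OF cU uv(1)] mult_mat_vec_index[OF cU uv(2)]
    by (intro sum.cong refl) (simp add: sum_product, simp add: ac_simps)
  also have "\<dots> = (\<Sum>c<d. \<Sum>c'<d. cnj (u $ c) * v $ c' * (\<Sum>k<d. cnj (U $$ (k, c)) * U $$ (k, c')))"
    unfolding sum_distrib_left by (subst sum.swap, rule sum.cong, rule refl, rule sum.swap)
  also have "\<dots> = (\<Sum>c<d. \<Sum>c'<d. if c = c' then cnj (u $ c) * v $ c' else 0)"
    using U by (intro sum.cong refl) (auto simp: unitary_mat_iff)
  finally show ?thesis by simp
qed

lemma vec_norm_inner: "complex_of_real ((vec_norm d v)\<^sup>2) = (\<Sum>k<d. cnj (v $ k) * v $ k)"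
  unfolding vec_norm_square of_real_sum
  by (intro sum.cong refl) (metis complex_norm_square mult.commute)

lemma unitary_mat_vec_norm: "vec_norm d (U *\<^sub>v v) = vec_norm d v"
  if U: "unitary_mat d U" and v: "v \<in> carrier_vec d"
proof -
  have "complex_of_real ((vec_norm d (U *\<^sub>v v))\<^sup>2) = complex_of_real ((vec_norm d v)\<^sup>2)"
    unfolding vec_norm_inner by (rule unitary_mat_inner[OF U v v])
  then have "(vec_norm d (U *\<^sub>v v))\<^sup>2 = (vec_norm d v)\<^sup>2" using of_real_eq_iff by blast
  then show ?thesis by (simp add: vec_norm_def L2_set_nonneg power2_eq_iff_nonneg)
qed

lemma vec_norm_triangle: "vec_norm d (u - w) \<le> vec_norm d (u - v) + vec_norm d (v - w)"
  if "u \<in> carrier_vec d" "v \<in> carrier_vec d" "w \<in> carrier_vec d"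
proof -
  have "cmod (u $ k - w $ k) \<le> cmod (u $ k - v $ k) + cmod (v $ k - w $ k)" for k
    using norm_triangle_ineq[of "u $ k - v $ k" "v $ k - w $ k"] by simp
  then have "L2_set (\<lambda>k. cmod ((u - w) $ k)) {..<d}
      \<le> L2_set (\<lambda>k. cmod ((u - v) $ k) + cmod ((v - w) $ k)) {..<d}"
    using that by (intro L2_set_mono) auto
  also have "\<dots> \<le> vec_norm d (u - v) + vec_norm d (v - w)"
    unfolding vec_norm_def by (rule L2_set_triangle_ineq)
  finally show ?thesis by (simp add: vec_norm_def)
qed


section \<open>The hybrid lower bound\<close>

text \<open>For a unit vector \<open>s\<close>, the probability that measuring the query register
  yields a position where \<open>x\<close> and \<open>y\<close> disagree.\<close>

definition query_mass :: "nat \<Rightarrow> nat \<Rightarrow> complex vec \<Rightarrow> bool list \<Rightarrow> bool list \<Rightarrow> real" where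
  "query_mass n w s x y = (\<Sum>r<state_dim n w. of_bool (x ! query_pos w r \<noteq> y ! query_pos w r) * (cmod (s $ r))\<^sup>2)"

text \<open>The two queries act alike where \<open>x\<close> and \<open>y\<close> agree. On the
  remaining basis states each result has norm \<open>sqrt (query_mass n w s x y)\<close>, because a
  query preserves the query position; the factor 2 is the triangle inequality.\<close>

lemma query_difference:
  assumes s: "s \<in> carrier_vec (state_dim n w)"
  shows "vec_norm (state_dim n w) (query_mat n w x *\<^sub>v s - query_mat n w y *\<^sub>v s) \<le> 2 * sqrt (query_mass n w s x y)"
proof -
  let ?d = "state_dim n w"
  let ?D = "\<lambda>r. of_bool (x ! query_pos w r \<noteq> y ! query_pos w r) :: real"
  have part: "L2_set (\<lambda>r. ?D r * cmod (s $ query_index w q r)) {..<?d} = sqrt (query_mass n w s x y)" for q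
  proof -
    have "(\<Sum>r<?d. (?D r * cmod (s $ query_index w q r))\<^sup>2)
        = (\<Sum>r<?d. ?D (query_index w q r) * (cmod (s $ query_index w q r))\<^sup>2)"
      by (intro sum.cong refl) (auto simp: query_pos_query_index workspace_pos)
    then show ?thesis
      unfolding query_index_sum[of "\<lambda>r. ?D r * (cmod (s $ r))\<^sup>2"]
      by (simp add: L2_set_def query_mass_def)
  qed
  have "cmod ((query_mat n w x *\<^sub>v s - query_mat n w y *\<^sub>v s) $ r)
      \<le> ?D r * cmod (s $ query_index w x r) + ?D r * cmod (s $ query_index w y r)" if "r < ?d" for r
  proof -
    have "(query_mat n w x *\<^sub>v s - query_mat n w y *\<^sub>v s) $ r = s $ query_index w x r - s $ query_index w y r"
      using that s query_mat_carrier[of n w y]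
      by (subst index_minus_vec) (auto simp: query_mat_vec_index simp del: index_mult_mat_vec)
    then show ?thesis by (auto simp: query_index_def norm_triangle_ineq4)
  qed
  then have "vec_norm ?d (query_mat n w x *\<^sub>v s - query_mat n w y *\<^sub>v s)
      \<le> L2_set (\<lambda>r. ?D r * cmod (s $ query_index w x r) + ?D r * cmod (s $ query_index w y r)) {..<?d}"
    unfolding vec_norm_def by (intro L2_set_mono) auto
  also have "\<dots> \<le> sqrt (query_mass n w s x y) + sqrt (query_mass n w s x y)"
    using L2_set_triangle_ineq[of "\<lambda>r. ?D r * cmod (s $ query_index w x r)"
        "\<lambda>r. ?D r * cmod (s $ query_index w y r)" "{..<?d}"] by (simp only: part)
  finally show ?thesis by simp
qed

lemma state_after_carrier:
  assumes "valid_algorithm n A" "j \<le> queries A"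
  shows "state_after n A y j \<in> carrier_vec (state_dim n (workspace A))"
  using assms
  by (cases j) (auto simp: valid_algorithm_def unitary_mat_def intro!: carrier_vecI dest: spec[of _ j])

lemma query_vec_carrier:
  "v \<in> carrier_vec (state_dim n w) \<Longrightarrow> query_mat n w y *\<^sub>v v \<in> carrier_vec (state_dim n w)"
  using query_mat_carrier by (rule mult_mat_vec_carrier)

lemma state_after_norm:
  assumes A: "valid_algorithm n A" and n: "0 < n"
  shows "j \<le> queries A \<Longrightarrow> vec_norm (state_dim n (workspace A)) (state_after n A y j) = 1"
proof (induction j)
  case 0
  let ?d = "state_dim n (workspace A)"
  have "basis_index (workspace A) 0 False 0 < ?d"
    using A n by (intro basis_index_less) (auto simp: valid_algorithm_def)
  moreover have "(\<Sum>k<?d. (cmod (unit_vec ?d i $ k))\<^sup>2) = (\<Sum>k<?d. if k = i then 1 else 0)" for i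
    by (intro sum.cong) (auto simp: unit_vec_def)
  ultimately have "vec_norm ?d (unit_vec ?d (basis_index (workspace A) 0 False 0)) = 1"
    by (simp add: vec_norm_def L2_set_def del: index_unit_vec)
  then show ?case using A by (simp add: unitary_mat_vec_norm valid_algorithm_def)
next
  case (Suc j)
  have "unitary_mat (state_dim n (workspace A)) (unitaries A (Suc j))"
    using A Suc.prems by (auto simp: valid_algorithm_def)
  then show ?case
    using Suc state_after_carrier[OF A, of j y]
    by (simp add: unitary_mat_vec_norm query_mat_unitary query_vec_carrier)
qed

text \<open>Only the run on \<open>x\<close> enters the bound. This makes it possible to add up the
  bounds for many inputs \<open>y\<close> against the same states.\<close>

lemma hybrid_distance:
  assumes A: "valid_algorithm n A"
  shows "j \<le> queries A \<Longrightarrow>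
    vec_norm (state_dim n (workspace A)) (state_after n A x j - state_after n A y j)
      \<le> (\<Sum>i<j. 2 * sqrt (query_mass n (workspace A) (state_after n A x i) x y))"
proof (induction j)
  case 0
  have "state_after n A x 0 \<in> carrier_vec (state_dim n (workspace A))"
    "state_after n A y 0 = state_after n A x 0"
    using state_after_carrier[OF A, of 0 x] by simp_all
  then show ?case by (simp add: vec_norm_def L2_set_0' del: state_after.simps)
next
  case (Suc j)
  let ?w = "workspace A"
  let ?d = "state_dim n ?w"
  let ?Q = "query_mat n ?w"
  let ?sx = "state_after n A x j" and ?sy = "state_after n A y j" and ?U = "unitaries A (Suc j)"
  have U: "unitary_mat ?d ?U" using A Suc.prems by (auto simp: valid_algorithm_def)
  have c: "?sx \<in> carrier_vec ?d" "?sy \<in> carrier_vec ?d"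
    using A Suc.prems by (auto intro!: state_after_carrier)
  note q = query_vec_carrier[OF c(1)] query_vec_carrier[OF c(2)]
  have "vec_norm ?d (?U *\<^sub>v (?Q x *\<^sub>v ?sx) - ?U *\<^sub>v (?Q y *\<^sub>v ?sy))
      = vec_norm ?d (?U *\<^sub>v (?Q x *\<^sub>v ?sx - ?Q y *\<^sub>v ?sy))"
    using unitary_mat_carrier[OF U] q by (subst mult_minus_distrib_mat_vec) auto
  also have "\<dots> = vec_norm ?d (?Q x *\<^sub>v ?sx - ?Q y *\<^sub>v ?sy)"
    using q by (intro unitary_mat_vec_norm[OF U]) auto
  \<comment> \<open>The hybrid vector queries \<open>y\<close> from the state of the run on
    \<open>x\<close>: one term is the new error, the other the old distance.\<close>
  also have "\<dots> \<le> vec_norm ?d (?Q x *\<^sub>v ?sx - ?Q y *\<^sub>v ?sx) + vec_norm ?d (?Q y *\<^sub>v ?sx - ?Q y *\<^sub>v ?sy)"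
    using q by (intro vec_norm_triangle) auto
  also have "vec_norm ?d (?Q y *\<^sub>v ?sx - ?Q y *\<^sub>v ?sy) = vec_norm ?d (?Q y *\<^sub>v (?sx - ?sy))"
    using c query_mat_carrier by (subst mult_minus_distrib_mat_vec) auto
  also have "\<dots> = vec_norm ?d (?sx - ?sy)"
    using c by (intro unitary_mat_vec_norm[OF query_mat_unitary]) auto
  finally show ?case using query_difference[OF c(1), of x y] Suc by simp
qed

text \<open>Certain acceptance makes the final state on \<open>x\<close> vanish at every rejecting
  outcome, where the state on \<open>y\<close> has squared norm at least 1/2.\<close>

lemma accepted_rejected_distance:
  assumes A: "valid_algorithm n A" and n: "0 < n"
    and x: "accept_prob n A x = 1" and y: "reject_prob n A y \<ge> 1 / 2"
  shows "1 / sqrt 2 \<le> vec_norm (state_dim n (workspace A))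
    (state_after n A x (queries A) - state_after n A y (queries A))"
proof -
  let ?d = "state_dim n (workspace A)" and ?T = "queries A"
  let ?s = "\<lambda>y k. state_after n A y ?T $ k"
  have acc: "accepting A \<subseteq> {..<?d}" using A by (simp add: valid_algorithm_def)
  have rest: "(\<Sum>k\<in>{..<?d} - accepting A. (cmod (?s y k))\<^sup>2) = 1 - accept_prob n A y" for y
    using state_after_norm[OF A n, of ?T y] vec_norm_square[of ?d "state_after n A y ?T"]
    by (simp add: sum_diff[OF _ acc] accept_prob_def)
  have "\<forall>k\<in>{..<?d} - accepting A. ?s x k = 0"
    using rest[of x] x sum_nonneg_eq_0_iff[of "{..<?d} - accepting A" "\<lambda>k. (cmod (?s x k))\<^sup>2"] by simp
  then have "(\<Sum>k\<in>{..<?d} - accepting A. (cmod (?s y k))\<^sup>2)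
      = (\<Sum>k\<in>{..<?d} - accepting A. (cmod (?s x k - ?s y k))\<^sup>2)"
    by (intro sum.cong refl) simp
  also have "\<dots> \<le> (\<Sum>k<?d. (cmod (?s x k - ?s y k))\<^sup>2)"
    by (intro sum_mono2) auto
  also have "\<dots> = (vec_norm ?d (state_after n A x ?T - state_after n A y ?T))\<^sup>2"
    unfolding vec_norm_square
    using state_after_carrier[OF A, of ?T x] state_after_carrier[OF A, of ?T y] by simp
  finally have "1 / 2 \<le> (vec_norm ?d (state_after n A x ?T - state_after n A y ?T))\<^sup>2"
    using rest[of y] y by (simp add: reject_prob_def)
  then have "sqrt (1 / 2) \<le> vec_norm ?d (state_after n A x ?T - state_after n A y ?T)"
    by (intro real_le_lsqrt) (auto simp: vec_norm_def)
  then show ?thesis by (simp add: real_sqrt_divide)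
qed

text \<open>Disjointness charges each query position to at most one \<open>k\<close>, so the masses
  add up to at most the squared norm of the state.\<close>

lemma query_mass_sum_le:
  assumes A: "valid_algorithm n A" and n: "0 < n" and j: "j \<le> queries A"
    and Y: "sensitive_family n f x N Y"
  shows "(\<Sum>k<N. query_mass n (workspace A) (state_after n A x j) x (Y k)) \<le> 1"
proof -
  let ?w = "workspace A" and ?s = "state_after n A x j"
  have "(\<Sum>k<N. of_bool (x ! i \<noteq> Y k ! i)) \<le> (1::real)" if "i < n" for i
  proof (cases "\<exists>k<N. x ! i \<noteq> Y k ! i")
    case True
    then obtain k where k: "k < N" "x ! i \<noteq> Y k ! i" by blast
    have "(\<Sum>l<N. of_bool (x ! i \<noteq> Y l ! i)) \<le> (\<Sum>l<N. of_bool (l = k) :: real)"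
      using Y k that by (intro sum_mono) (auto simp: sensitive_family_def)
    also have "\<dots> \<le> 1" by (simp add: of_bool_def)
    finally show ?thesis .
  qed simp
  then have "(\<Sum>r<state_dim n ?w. (\<Sum>k<N. of_bool (x ! query_pos ?w r \<noteq> Y k ! query_pos ?w r)) * (cmod (?s $ r))\<^sup>2)
      \<le> (\<Sum>r<state_dim n ?w. 1 * (cmod (?s $ r))\<^sup>2)"
    by (intro sum_mono mult_right_mono) (auto simp: query_pos_less)
  also have "\<dots> = 1"
    using vec_norm_square[of "state_dim n ?w" ?s] state_after_norm[OF A n j, of x] by simp
  finally show ?thesis
    unfolding query_mass_def sum_distrib_right by (subst sum.swap) simp
qed

text \<open>Summed over \<open>k\<close>, the final distances are at least
  \<open>N / sqrt 2\<close>. By Cauchy-Schwarz and the total mass bound, each of the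
  \<open>T\<close> queries contributes at most \<open>2 * sqrt N\<close>.\<close>

theorem quantum_verifier_lower_bound:
  assumes A: "quantum_verifier n f x A" and n: "0 < n" and Y: "sensitive_family n f x N Y"
  shows "sqrt (real N) \<le> 2 * sqrt 2 * real (queries A)"
proof (cases "N = 0")
  case False
  let ?w = "workspace A" and ?T = "queries A"
  let ?d = "state_dim n ?w"
  let ?m = "\<lambda>j k. query_mass n ?w (state_after n A x j) x (Y k)"
  have V: "valid_algorithm n A" using A by (simp add: quantum_verifier_def)
  have m0: "0 \<le> ?m j k" for j k by (simp add: query_mass_def sum_nonneg)
  have "real N * (1 / sqrt 2) = (\<Sum>k<N. 1 / sqrt 2)" by simp
  also have "\<dots> \<le> (\<Sum>k<N. vec_norm ?d (state_after n A x ?T - state_after n A (Y k) ?T))"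
    using A Y by (intro sum_mono accepted_rejected_distance V n)
      (auto simp: quantum_verifier_def sensitive_family_def)
  also have "\<dots> \<le> (\<Sum>k<N. \<Sum>j<?T. 2 * sqrt (?m j k))"
    by (intro sum_mono hybrid_distance V) simp
  also have "\<dots> = (\<Sum>j<?T. 2 * (\<Sum>k<N. sqrt (?m j k)))"
    by (subst sum.swap) (simp add: sum_distrib_left)
  also have "\<dots> \<le> (\<Sum>j<?T. 2 * sqrt (real N))"
  proof (intro sum_mono mult_left_mono)
    fix j assume "j \<in> {..<?T}"
    then have "(\<Sum>k<N. ?m j k) \<le> 1"
      by (intro query_mass_sum_le[OF V n _ Y]) auto
    then have "L2_set (\<lambda>k. sqrt (?m j k)) {..<N} \<le> 1"
      using m0 by (simp add: L2_set_def)
    then have "L2_set (\<lambda>_. 1) {..<N} * L2_set (\<lambda>k. sqrt (?m j k)) {..<N} \<le> sqrt (real N)"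
      by (simp add: L2_set_def mult_left_le)
    then show "(\<Sum>k<N. sqrt (?m j k)) \<le> sqrt (real N)"
      using L2_set_mult_ineq[of "\<lambda>_. 1" "\<lambda>k. sqrt (?m j k)" "{..<N}"] m0 by simp
  qed simp
  finally have "real N \<le> sqrt 2 * (real ?T * (2 * sqrt (real N)))"
    by (simp add: field_simps)
  then have "sqrt (real N) * sqrt (real N) \<le> (2 * sqrt 2 * real ?T) * sqrt (real N)"
    by (simp add: algebra_simps)
  then show ?thesis using False by (elim mult_right_le_imp_le) simp
qed simp

section \<open>Amplitude amplification with a superposed number of iterations\<close>

lemma unitary_mat_mult: "unitary_mat d (U * V)" if U: "unitary_mat d U" and V: "unitary_mat d V"
proof -
  have c: "U \<in> carrier_mat d d" "V \<in> carrier_mat d d"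
    using that by (auto intro: unitary_mat_carrier)
  have UV: "(U * V) $$ (r, k) = (U *\<^sub>v col V k) $ r" if "r < d" "k < d" for r k
    using that c by simp
  have "(\<Sum>r<d. cnj ((U * V) $$ (r, k)) * (U * V) $$ (r, k')) = of_bool (k = k')" if k: "k < d" "k' < d" for k k'
  proof -
    have "(\<Sum>r<d. cnj ((U * V) $$ (r, k)) * (U * V) $$ (r, k'))
        = (\<Sum>r<d. cnj ((U *\<^sub>v col V k) $ r) * (U *\<^sub>v col V k') $ r)"
      using k by (intro sum.cong refl) (simp only: lessThan_iff UV)
    also have "\<dots> = (\<Sum>r<d. cnj (col V k $ r) * col V k' $ r)"
      using k c by (intro unitary_mat_inner[OF U]) auto
    also have "\<dots> = of_bool (k = k')"
      using V k c by (simp add: unitary_mat_iff)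
    finally show ?thesis .
  qed
  then show ?thesis using c by (simp add: unitary_mat_iff)
qed

section \<open>Reflections in orthonormal families\<close>

definition reflection_mat :: "nat \<Rightarrow> nat \<Rightarrow> (nat \<Rightarrow> nat \<Rightarrow> real) \<Rightarrow> complex mat" where
  "reflection_mat d w v = mat d d (\<lambda>(r, c). of_real (of_bool (r = c) - 2 * (\<Sum>z<w. v z r * v z c)))"

text \<open>For the projection \<open>P\<close> with entries \<open>S\<close>, orthonormality gives
  \<open>P * P = P\<close>, so the square of the symmetric matrix \<open>1 - 2 * P\<close> is the
  identity.\<close>

lemma reflection_mat_unitary:
  assumes orth: "\<And>z z'. \<lbrakk>z < w; z' < w\<rbrakk> \<Longrightarrow> (\<Sum>r<d. v z r * v z' r) = of_bool (z = z')"
  shows "unitary_mat d (reflection_mat d w v)"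
  unfolding unitary_mat_iff
proof (intro conjI allI impI)
  show "reflection_mat d w v \<in> carrier_mat d d" by (simp add: reflection_mat_def)
  fix c c' assume c: "c < d" "c' < d"
  define S where "S r c = (\<Sum>z<w. v z r * v z c)" for r c
  have S_comm: "S r c = S c r" for r c by (simp add: S_def mult.commute)
  have "(\<Sum>r<d. S r c * S r c') = (\<Sum>r<d. \<Sum>z<w. \<Sum>z'<w. v z c * v z' c' * (v z r * v z' r))"
    unfolding S_def sum_product by (intro sum.cong refl) simp
  also have "\<dots> = (\<Sum>z<w. \<Sum>z'<w. v z c * v z' c' * (\<Sum>r<d. v z r * v z' r))"
    unfolding sum_distrib_left by (subst sum.swap, rule sum.cong, rule refl, rule sum.swap)
  also have "\<dots> = (\<Sum>z<w. \<Sum>z'<w. if z = z' then v z c * v z' c' else 0)"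
    by (intro sum.cong refl) (simp add: orth)
  also have "\<dots> = S c c'" by (simp add: S_def)
  finally have SS: "(\<Sum>r<d. S r c * S r c') = S c c'" .
  have "(\<Sum>r<d. cnj (reflection_mat d w v $$ (r, c)) * reflection_mat d w v $$ (r, c'))
      = of_real (\<Sum>r<d. (of_bool (r = c) - 2 * S r c) * (of_bool (r = c') - 2 * S r c'))"
    unfolding of_real_sum using c by (intro sum.cong refl) (simp add: reflection_mat_def S_def)
  also have "(\<Sum>r<d. (of_bool (r = c) - 2 * S r c) * (of_bool (r = c') - 2 * S r c'))
      = (\<Sum>r<d. (if r = c then of_bool (r = c') else 0) - (if r = c then 2 * S r c' else 0)
          - (if r = c' then 2 * S r c else 0) + 4 * (S r c * S r c'))"
    by (intro sum.cong refl) (auto simp: algebra_simps)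
  also have "\<dots> = of_bool (c = c') - 2 * S c c' - 2 * S c' c + 4 * S c c'"
    using c by (simp add: sum.distrib sum_subtractf sum_distrib_left[symmetric] SS)
  also have "\<dots> = of_bool (c = c')" by (simp add: S_comm[of c' c])
  finally show "(\<Sum>r<d. cnj (reflection_mat d w v $$ (r, c)) * reflection_mat d w v $$ (r, c')) = of_bool (c = c')"
    by simp
qed

lemma reflection_mat_vec_index:
  assumes "r < d"
  shows "(reflection_mat d w v *\<^sub>v vec d (\<lambda>k. of_real (u k))) $ r
    = of_real (u r - 2 * (\<Sum>z<w. v z r * (\<Sum>c<d. v z c * u c)))"
proof -
  have "(reflection_mat d w v *\<^sub>v vec d (\<lambda>k. of_real (u k))) $ r
      = of_real (\<Sum>c<d. (of_bool (r = c) - 2 * (\<Sum>z<w. v z r * v z c)) * u c)"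
    using assms by (subst mult_mat_vec_index[of _ d d]) (auto simp: reflection_mat_def intro!: sum.cong)
  also have "(\<Sum>c<d. (of_bool (r = c) - 2 * (\<Sum>z<w. v z r * v z c)) * u c)
      = (\<Sum>c<d. (if r = c then u c else 0) - (\<Sum>z<w. 2 * (v z r * (v z c * u c))))"
    by (intro sum.cong refl) (simp add: left_diff_distrib sum_distrib_left sum_distrib_right mult.assoc)
  also have "\<dots> = u r - (\<Sum>z<w. \<Sum>c<d. 2 * (v z r * (v z c * u c)))"
    unfolding sum_subtractf using assms by (subst sum.swap) simp
  finally show ?thesis by (simp add: sum_distrib_left)
qed

text \<open>A Householder reflection exchanging the first basis vector with \<open>t\<close>.\<close>

lemma ex_unitary_first_row_column:
  assumes t: "(\<Sum>r<d. (t r)\<^sup>2) = (1::real)" and d: "0 < d"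
  shows "\<exists>U. unitary_mat d U \<and> (\<forall>c<d. U $$ (c, 0) = of_real (t c) \<and> U $$ (0, c) = of_real (t c))"
\<comment> \<open>Here \<open>t\<close> is the first basis vector, the reflecting vector would be
  zero, and the identity is taken instead.\<close>
proof (cases "t 0 = 1")
  case True
  have "(\<Sum>r<d. (t r)\<^sup>2) = (t 0)\<^sup>2 + (\<Sum>r\<in>{..<d} - {0}. (t r)\<^sup>2)"
    using d by (intro sum.remove) auto
  then have "(\<Sum>r\<in>{..<d} - {0}. (t r)\<^sup>2) = 0" using t True by simp
  then have "t r = 0" if "r < d" "r \<noteq> 0" for r
    using that sum_nonneg_eq_0_iff[of "{..<d} - {0}" "\<lambda>r. (t r)\<^sup>2"] by simp
  then have "(1\<^sub>m d :: complex mat) $$ (c, 0) = of_real (t c)" "(1\<^sub>m d :: complex mat) $$ (0, c) = of_real (t c)"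
    if "c < d" for c
    using that d True by (cases "c = 0"; simp)+
  moreover have "unitary_mat d (1\<^sub>m d)"
    by (auto simp: unitary_mat_iff of_bool_def if_distrib cong: if_cong)
  ultimately show ?thesis by blast
next
  case False
  define e where "e r = (of_bool (r = 0) :: real)" for r :: nat
  define v where "v z r = (t r - e r) / sqrt (2 - 2 * t 0)" for z r :: nat
  have "(t 0)\<^sup>2 \<le> (\<Sum>r<d. (t r)\<^sup>2)" using d by (intro member_le_sum) auto
  then have "t 0 \<le> 1" using t abs_square_le_1[of "t 0"] by simp
  then have lt: "t 0 < 1" using False by simp
  then have vv: "v z r * v z' c = (t r - e r) * (t c - e c) / (2 - 2 * t 0)" for z z' r c
    by (simp add: v_def)
  have "(\<Sum>r<d. (t r - e r) * (t r - e r)) = (\<Sum>r<d. (t r)\<^sup>2 - (if r = 0 then 2 * t r else 0) + (if r = 0 then 1 else 0))"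
    by (intro sum.cong refl) (auto simp: e_def power2_eq_square algebra_simps)
  also have "\<dots> = 2 - 2 * t 0" using d t by (simp add: sum.distrib sum_subtractf)
  finally have "(\<Sum>r<d. v z r * v z' r) = 1" for z z'
    unfolding vv sum_divide_distrib[symmetric] using lt by simp
  then have unitary: "unitary_mat d (reflection_mat d 1 v)"
    by (intro reflection_mat_unitary) simp
  have "e r - 2 * (v 0 r * v 0 0) = t r" "e r - 2 * (v 0 0 * v 0 r) = t r" for r
    unfolding vv using lt by (simp_all add: e_def field_simps)
  moreover have "reflection_mat d 1 v $$ (r, c) = of_real (of_bool (r = c) - 2 * (v 0 r * v 0 c))"
    if "r < d" "c < d" for r c
    using that by (simp add: reflection_mat_def)
  ultimately have "reflection_mat d 1 v $$ (c, 0) = of_real (t c)" "reflection_mat d 1 v $$ (0, c) = of_real (t c)"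
    if "c < d" for c
    using that d by (simp_all only: e_def eq_commute[of 0 c])
  with unitary show ?thesis by blast
qed

section \<open>Real amplitudes and the operators of a Grover iteration\<close>

definition answer_sign :: "bool \<Rightarrow> real" where "answer_sign b = (if b then - 1 else 1)"

lemma answer_sign_simps [simp]: "answer_sign False = 1" "answer_sign True = - 1" "answer_sign b * answer_sign b = 1"
  by (auto simp: answer_sign_def)

definition real_state :: "nat \<Rightarrow> nat \<Rightarrow> (nat \<Rightarrow> bool \<Rightarrow> nat \<Rightarrow> real) \<Rightarrow> complex vec" where
  "real_state n w F = vec (state_dim n w) (\<lambda>r. of_real (F (query_pos w r) (answer_bit w r) (r mod w)))"

lemma real_state_carrier: "real_state n w F \<in> carrier_vec (state_dim n w)"
  by (simp add: real_state_def)

lemma real_state_cong: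
  "real_state n w F = real_state n w F'" if "\<And>i b z. \<lbrakk>i < n; z < w\<rbrakk> \<Longrightarrow> F i b z = F' i b z"
  unfolding real_state_def using that by (intro eq_vecI) (auto simp: query_pos_less workspace_pos)

lemma state_sum: "(\<Sum>r<state_dim n w. F (query_pos w r) (answer_bit w r) (r mod w)) = (\<Sum>i<n. \<Sum>z<w. F i False z + F i True z)"
  for F :: "nat \<Rightarrow> bool \<Rightarrow> nat \<Rightarrow> 'a :: comm_monoid_add"
proof -
  let ?H = "\<lambda>r. F (query_pos w r) (answer_bit w r) (r mod w)"
  have H: "?H ((i * 2 + of_bool b) * w + z) = F i b z" if "z < w" for i b z
    using that query_pos_basis_index[OF that, of i b] answer_bit_basis_index[OF that, of i b] mod_basis_index[OF that, of i b]
    by (simp only: basis_index_def mult.commute[of i 2])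
  have two: "(\<Sum>b<2. K b) = K (of_bool False) + K (of_bool True)" for K :: "nat \<Rightarrow> 'a"
    by (simp add: numeral_2_eq_2)
  have "(\<Sum>r<state_dim n w. ?H r) = (\<Sum>i<n. \<Sum>b<2. \<Sum>z<w. ?H ((i * 2 + b) * w + z))"
    unfolding state_dim_def sum_mult_index ..
  also have "\<dots> = (\<Sum>i<n. (\<Sum>z<w. ?H ((i * 2 + of_bool False) * w + z)) + (\<Sum>z<w. ?H ((i * 2 + of_bool True) * w + z)))"
    by (intro sum.cong refl two)
  also have "\<dots> = (\<Sum>i<n. (\<Sum>z<w. F i False z) + (\<Sum>z<w. F i True z))"
    by (intro sum.cong refl arg_cong2[of _ _ _ _ "(+)"]) (simp_all only: H lessThan_iff)
  finally show ?thesis by (simp add: sum.distrib)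
qed

lemma query_real_state:
  "query_mat n w y *\<^sub>v real_state n w F = real_state n w (\<lambda>i b z. F i (b \<noteq> y ! i) z)"
proof (rule eq_vecI)
  fix r assume "r < dim_vec (real_state n w (\<lambda>i b z. F i (b \<noteq> y ! i) z))"
  then have r: "r < state_dim n w" by (simp add: real_state_def)
  show "(query_mat n w y *\<^sub>v real_state n w F) $ r = real_state n w (\<lambda>i b z. F i (b \<noteq> y ! i) z) $ r"
    using r query_index_less[OF r] workspace_pos[OF r]
    by (subst query_mat_vec_index[OF real_state_carrier r]) (simp add: real_state_def query_index_def)
qed (simp add: query_mat_def real_state_def)

definition phase_mat :: "nat \<Rightarrow> nat \<Rightarrow> nat \<Rightarrow> complex mat" where
  "phase_mat n w j = mat (state_dim n w) (state_dim n w)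
     (\<lambda>(r, c). of_bool (r = c) * of_real (if r mod w = j then answer_sign (answer_bit w r) else 1))"

lemma phase_mat_unitary: "unitary_mat (state_dim n w) (phase_mat n w j)"
  unfolding unitary_mat_iff
proof (intro conjI allI impI)
  fix c c' assume c: "c < state_dim n w" "c' < state_dim n w"
  have "(\<Sum>r<state_dim n w. cnj (phase_mat n w j $$ (r, c)) * phase_mat n w j $$ (r, c'))
      = (\<Sum>r<state_dim n w. if r = c then of_bool (c = c') else 0)"
    using c by (intro sum.cong refl) (auto simp: phase_mat_def answer_sign_def)
  then show "(\<Sum>r<state_dim n w. cnj (phase_mat n w j $$ (r, c)) * phase_mat n w j $$ (r, c')) = of_bool (c = c')"
    using c by simp
qed (simp add: phase_mat_def)

lemma phase_real_state:
  "phase_mat n w j *\<^sub>v real_state n w F = real_state n w (\<lambda>i b z. (if z = j then answer_sign b else 1) * F i b z)"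
  (is "_ = real_state n w ?F'")
proof (rule eq_vecI)
  fix r assume "r < dim_vec (real_state n w ?F')"
  then have r: "r < state_dim n w" by (simp add: real_state_def)
  have "(phase_mat n w j *\<^sub>v real_state n w F) $ r
      = (\<Sum>c<state_dim n w. phase_mat n w j $$ (r, c) * real_state n w F $ c)"
    using r by (intro mult_mat_vec_index real_state_carrier) (auto simp: phase_mat_def)
  also have "\<dots> = (\<Sum>c<state_dim n w. if c = r then real_state n w ?F' $ c else 0)"
    using r by (intro sum.cong refl) (auto simp: phase_mat_def real_state_def)
  finally have "(phase_mat n w j *\<^sub>v real_state n w F) $ r
      = (\<Sum>c<state_dim n w. if c = r then real_state n w ?F' $ c else 0)" .
  then show "(phase_mat n w j *\<^sub>v real_state n w F) $ r = real_state n w ?F' $ r"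
    using r by simp
qed (simp add: phase_mat_def real_state_def)

definition branch :: "nat \<Rightarrow> (nat \<Rightarrow> real) \<Rightarrow> nat \<Rightarrow> nat \<Rightarrow> real" where
  "branch w p z r = of_bool (r mod w = z) * p (query_pos w r) * answer_sign (answer_bit w r) / sqrt 2"

lemma branch_sum:
  assumes "z < w"
  shows "(\<Sum>r<state_dim n w. branch w p z r * F (query_pos w r) (answer_bit w r) (r mod w))
    = (\<Sum>i<n. p i * (F i False z - F i True z)) / sqrt 2"
proof -
  have "(\<Sum>r<state_dim n w. branch w p z r * F (query_pos w r) (answer_bit w r) (r mod w))
      = (\<Sum>i<n. \<Sum>z'<w. (of_bool (z' = z) * p i * answer_sign False / sqrt 2) * F i False z'
          + (of_bool (z' = z) * p i * answer_sign True / sqrt 2) * F i True z')"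
    unfolding branch_def
    using state_sum[of "\<lambda>i b z'. (of_bool (z' = z) * p i * answer_sign b / sqrt 2) * F i b z'" w n] by simp
  also have "\<dots> = (\<Sum>i<n. \<Sum>z'<w. if z' = z then p i * (F i False z' - F i True z') / sqrt 2 else 0)"
    by (intro sum.cong refl) (auto simp: field_simps)
  also have "\<dots> = (\<Sum>i<n. p i * (F i False z - F i True z) / sqrt 2)" using assms by simp
  finally show ?thesis by (simp add: sum_divide_distrib)
qed

lemma branch_orthonormal:
  assumes p: "(\<Sum>i<n. (p i)\<^sup>2) = 1" and z: "z < w" "z' < w"
  shows "(\<Sum>r<state_dim n w. branch w p z r * branch w p z' r) = of_bool (z = z')"
proof -
  have "(\<Sum>r<state_dim n w. branch w p z r * branch w p z' r)
      = (\<Sum>i<n. p i * (of_bool (z = z') * p i * answer_sign False / sqrt 2 - of_bool (z = z') * p i * answer_sign True / sqrt 2)) / sqrt 2"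
    using branch_sum[OF z(1), of p "\<lambda>i b u. of_bool (u = z') * p i * answer_sign b / sqrt 2" n]
    by (simp add: branch_def)
  also have "\<dots> = (\<Sum>i<n. of_bool (z = z') * (p i)\<^sup>2)"
    unfolding sum_divide_distrib by (intro sum.cong refl) (simp add: power2_eq_square)
  also have "\<dots> = of_bool (z = z')"
    by (simp add: sum_distrib_left[symmetric] p)
  finally show ?thesis .
qed

text \<open>Grover diffusion up to sign, in all branches at once. A branch with answer register
  \<open>|0> + |1>\<close> is orthogonal to every reflecting vector and stays fixed.\<close>

definition diffusion_mat :: "nat \<Rightarrow> nat \<Rightarrow> (nat \<Rightarrow> real) \<Rightarrow> complex mat" where
  "diffusion_mat n w p = reflection_mat (state_dim n w) w (branch w p)"

lemma diffusion_mat_unitary: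
  "(\<Sum>i<n. (p i)\<^sup>2) = 1 \<Longrightarrow> unitary_mat (state_dim n w) (diffusion_mat n w p)"
  unfolding diffusion_mat_def by (intro reflection_mat_unitary branch_orthonormal)

lemma diffusion_real_state:
  "diffusion_mat n w p *\<^sub>v real_state n w F
    = real_state n w (\<lambda>i b z. F i b z - answer_sign b * p i * (\<Sum>i'<n. p i' * (F i' False z - F i' True z)))"
  (is "_ = real_state n w ?F'")
proof (rule eq_vecI)
  fix r assume "r < dim_vec (real_state n w ?F')"
  then have r: "r < state_dim n w" by (simp add: real_state_def)
  let ?F = "\<lambda>r. F (query_pos w r) (answer_bit w r) (r mod w)"
  have z: "r mod w < w" using workspace_pos[OF r] by simp
  have "(\<Sum>z<w. branch w p z r * (\<Sum>c<state_dim n w. branch w p z c * ?F c))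
      = (\<Sum>z<w. if z = r mod w then p (query_pos w r) * answer_sign (answer_bit w r) / sqrt 2
          * ((\<Sum>i<n. p i * (F i False z - F i True z)) / sqrt 2) else 0)"
    by (intro sum.cong refl) (auto simp: branch_sum, simp_all add: branch_def)
  also have "\<dots> = p (query_pos w r) * answer_sign (answer_bit w r) * (\<Sum>i<n. p i * (F i False (r mod w) - F i True (r mod w))) / 2"
    using z by simp
  finally show "(diffusion_mat n w p *\<^sub>v real_state n w F) $ r = real_state n w ?F' $ r"
    using r unfolding diffusion_mat_def real_state_def
    by (subst reflection_mat_vec_index) (simp_all add: mult.commute mult.left_commute)
qed (simp add: diffusion_mat_def reflection_mat_def real_state_def)

text \<open>Starting from the amplitudes \<open>p\<close>, the amplitudes after \<open>k\<close> Grover iterations are \<open>p i * a\<close> at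
  marked and \<open>p i * b\<close> at unmarked positions, where \<open>(a, b) = grover e k\<close> and \<open>e\<close> is the weight of the
  marked positions. With \<open>e = sin\<^sup>2 \<theta>\<close>, these are \<open>a = sin ((2 k + 1) \<theta>) / sin \<theta>\<close> and
  \<open>b = cos ((2 k + 1) \<theta>) / cos \<theta>\<close>.\<close>

primrec grover :: "real \<Rightarrow> nat \<Rightarrow> real \<times> real" where
  "grover e 0 = (1, 1)"
| "grover e (Suc k) = (let (a, b) = grover e k; c = (1 - e) * b - e * a in (a + 2 * c, 2 * c - b))"

text \<open>Conservation of the norm; it bounds the marked amplitude \<open>a\<close> by
  \<open>e * a\<^sup>2 \<le> 1\<close>, however many iterations are made.\<close>

lemma grover_norm: "e * (fst (grover e k))\<^sup>2 + (1 - e) * (snd (grover e k))\<^sup>2 = 1"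
proof (induction k)
  case (Suc k)
  obtain a b where ab: "grover e k = (a, b)" by force
  define c where "c = (1 - e) * b - e * a"
  have "e * (a + 2 * c)\<^sup>2 + (1 - e) * (2 * c - b)\<^sup>2
      = e * a\<^sup>2 + (1 - e) * b\<^sup>2 + 4 * c * (e * a - (1 - e) * b) + 4 * c\<^sup>2"
    by (simp add: power2_eq_square algebra_simps)
  also have "\<dots> = 1" using Suc ab by (simp add: c_def power2_eq_square algebra_simps)
  finally show ?case by (simp add: ab Let_def c_def)
qed simp

text \<open>The overlap with the initial state after \<open>k + 1\<close> iterations is half the increment of the marked
  amplitude, so the sum of the overlaps telescopes.\<close>

lemma grover_overlap_sum:
  "(\<Sum>k<K. e * fst (grover e (Suc k)) + (1 - e) * snd (grover e (Suc k))) = (fst (grover e K) - 1) / 2"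
proof (induction K)
  case (Suc K)
  obtain a b where ab: "grover e K = (a, b)" by force
  show ?case using Suc by (simp add: ab Let_def field_simps)
qed simp

text \<open>For \<open>e = 0\<close> the first component belongs to no position, but its linear
  growth makes the telescoped average of the overlaps exactly 1.\<close>

lemma grover_unmarked: "grover 0 k = (1 + 2 * real k, 1)"
  by (induction k) (auto simp: Let_def)

text \<open>The workspace value \<open>z\<close> runs through a uniform superposition. Branch \<open>z\<close> keeps its answer bit
  in the state \<open>|0> - |1>\<close>, where queries act as phases, for \<open>z + 1\<close> iterations; the phase flip then
  turns it into \<open>|0> + |1>\<close>, which no later query affects. So the final overlap with the initial
  amplitudes is the average of the overlaps after \<open>1, \<dots>, K\<close> iterations.\<close>

definition grover_state ::
  "nat \<Rightarrow> (nat \<Rightarrow> real) \<Rightarrow> real \<Rightarrow> (nat \<Rightarrow> bool) \<Rightarrow> nat \<Rightarrow> nat \<Rightarrow> bool \<Rightarrow> nat \<Rightarrow> real" where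
  "grover_state K p e marked j i b z =
     p i * (if marked i then fst (grover e (min j (Suc z))) else snd (grover e (min j (Suc z))))
       * (if z < j then 1 else answer_sign b) / sqrt (2 * real K)"

text \<open>The complement of \<open>x\<close> makes the two queries negate the unmarked positions
  of an active branch. This sign cancels that of the diffusion, so no global sign per iteration
  remains. Such a sign would do harm, since the branches stop after different numbers of iterations
  and their overlaps would alternate in sign.\<close>

lemma grover_step:
  assumes x: "x \<in> cube n" and p: "(\<Sum>i<n. (p i)\<^sup>2) = 1"
    and e: "e = (\<Sum>i<n. (p i)\<^sup>2 * of_bool (x ! i \<noteq> y ! i))"
  shows "phase_mat n K j *\<^sub>v (diffusion_mat n K p *\<^sub>v (query_mat n K (map Not x) *\<^sub>v (query_mat n K y *\<^sub>v
      real_state n K (grover_state K p e (\<lambda>i. x ! i \<noteq> y ! i) j))))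
    = real_state n K (grover_state K p e (\<lambda>i. x ! i \<noteq> y ! i) (Suc j))"
proof -
  let ?m = "\<lambda>i. x ! i \<noteq> y ! i"
  let ?F = "grover_state K p e ?m j"
  obtain a b where ab: "grover e j = (a, b)" by force
  define c where "c = (1 - e) * b - e * a"
  define F2 where "F2 i q z = (if z < j then ?F i q z else
      p i * answer_sign q * (if ?m i then a else - b) / sqrt (2 * real K))" for i q z
  have F2: "?F i ((q \<noteq> map Not x ! i) \<noteq> y ! i) z = F2 i q z" if "i < n" for i q z
  proof -
    have nx: "map Not x ! i = (\<not> x ! i)" using x that by (simp add: cube_def)
    show ?thesis
      by (cases q; cases "x ! i"; cases "y ! i")
        (auto simp: nx F2_def grover_state_def ab min_def)
  qed
  \<comment> \<open>A stopped branch has equal amplitudes for both answers and overlap 0; in an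
    active one the overlap is a multiple of \<open>e * a - (1 - e) * b = - c\<close>.\<close>
  have sum_F2: "(\<Sum>i<n. p i * (F2 i False z - F2 i True z)) = (if z < j then 0 else - 2 * c / sqrt (2 * real K))" for z
  proof (cases "z < j")
    case True
    then show ?thesis by (simp add: F2_def grover_state_def)
  next
    case False
    have "(\<Sum>i<n. p i * (F2 i False z - F2 i True z))
        = (\<Sum>i<n. 2 * ((a + b) * ((p i)\<^sup>2 * of_bool (?m i)) - b * (p i)\<^sup>2) / sqrt (2 * real K))"
      using False by (intro sum.cong refl) (auto simp: F2_def power2_eq_square add_divide_distrib[symmetric] algebra_simps)
    also have "\<dots> = 2 * ((a + b) * e - b * 1) / sqrt (2 * real K)"
      unfolding e p[symmetric]
      by (simp add: sum_divide_distrib[symmetric] sum_distrib_left[symmetric] sum_subtractf)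
    also have "\<dots> = - 2 * c / sqrt (2 * real K)" by (simp add: c_def algebra_simps)
    finally show ?thesis using False by simp
  qed
  have final: "(if z = j then answer_sign q else 1) * (F2 i q z - answer_sign q * p i * (if z < j then 0 else - 2 * c / sqrt (2 * real K)))
      = grover_state K p e ?m (Suc j) i q z" for i q z
  proof -
    have gS: "grover e (Suc j) = (a + 2 * c, 2 * c - b)" by (simp add: ab c_def Let_def)
    consider "z < j" | "z = j" | "z > j" by linarith
    then show ?thesis
    proof cases
      case 1
      then have "min (Suc j) (Suc z) = Suc z" "min j (Suc z) = Suc z" by simp_all
      then show ?thesis using 1 by (simp add: F2_def grover_state_def del: grover.simps)
    next
      case 2
      then show ?thesis
        by (cases q) (auto simp: F2_def grover_state_def gS add_divide_distrib diff_divide_distrib algebra_simps simp del: grover.simps)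
    next
      case 3
      then have "min (Suc j) (Suc z) = Suc j" by simp
      then show ?thesis using 3
        by (cases q) (auto simp: F2_def grover_state_def gS add_divide_distrib diff_divide_distrib algebra_simps simp del: grover.simps)
    qed
  qed
  have "query_mat n K (map Not x) *\<^sub>v (query_mat n K y *\<^sub>v real_state n K ?F) = real_state n K F2"
    unfolding query_real_state using F2 by (intro real_state_cong) simp
  then show ?thesis
    by (simp only: diffusion_real_state phase_real_state sum_F2 final)
qed

text \<open>The only accepting outcome is basis state 0, and its final amplitude is the average
  overlap \<open>(a - 1) / (2 * K)\<close>, with \<open>a\<close> the marked amplitude after
  \<open>K\<close> iterations.\<close>

theorem ex_quantum_verifier:
  assumes x: "x \<in> cube n" and p: "(\<Sum>i<n. (p i)\<^sup>2) = 1"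
    and marked: "\<And>y. \<lbrakk>y \<in> cube n; f y \<noteq> f x\<rbrakk> \<Longrightarrow>
      2 \<le> (real K)\<^sup>2 * (\<Sum>i<n. (p i)\<^sup>2 * of_bool (x ! i \<noteq> y ! i))"
    and K: "0 < K" and n: "0 < n"
  shows "\<exists>A. quantum_verifier n f x A \<and> queries A = K"
proof -
  let ?d = "state_dim n K"
  \<comment> \<open>The start \<open>s\<close> has all branches active. The target \<open>t\<close>
    lacks the sign because after \<open>K\<close> steps every branch has been stopped.\<close>
  define s where "s r = p (query_pos K r) * answer_sign (answer_bit K r) / sqrt (2 * real K)" for r
  define t where "t r = p (query_pos K r) / sqrt (2 * real K)" for r
  have d: "0 < ?d" using n K by (simp add: state_dim_def)
  have "(\<Sum>r<?d. (t r)\<^sup>2) = (\<Sum>i<n. \<Sum>z<K. (p i)\<^sup>2 / real K)"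
    using state_sum[of "\<lambda>i b z. (p i / sqrt (2 * real K))\<^sup>2" K n]
    by (simp add: t_def power_divide)
  also have "\<dots> = (\<Sum>i<n. (p i)\<^sup>2)" using K by simp
  finally have norm_t: "(\<Sum>r<?d. (t r)\<^sup>2) = 1" using p by simp
  have "(s r)\<^sup>2 = (t r)\<^sup>2" for r by (simp add: s_def t_def answer_sign_def)
  then have norm_s: "(\<Sum>r<?d. (s r)\<^sup>2) = 1" using norm_t by simp
  obtain U where U: "unitary_mat ?d U" "\<forall>c<?d. U $$ (c, 0) = of_real (s c) \<and> U $$ (0, c) = of_real (s c)"
    using ex_unitary_first_row_column[OF norm_s d] by blast
  obtain V where V: "unitary_mat ?d V" "\<forall>c<?d. V $$ (c, 0) = of_real (t c) \<and> V $$ (0, c) = of_real (t c)"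
    using ex_unitary_first_row_column[OF norm_t d] by blast
  \<comment> \<open>The string \<open>x\<close> is known to the verifier, so its query matrix is
    part of the fixed unitaries and costs no query.\<close>
  define W where "W j = phase_mat n K j * (diffusion_mat n K p * query_mat n K (map Not x))" for j
  have W: "unitary_mat ?d (W j)" for j
    unfolding W_def by (intro unitary_mat_mult phase_mat_unitary diffusion_mat_unitary query_mat_unitary p)
  define A where "A = \<lparr>workspace = K, queries = K,
    unitaries = (\<lambda>j. if j = 0 then U else if j = K then V * W (j - 1) else W (j - 1)), accepting = {0}\<rparr>"
  have A_simps: "workspace A = K" "queries A = K" "accepting A = {0}" "unitaries A 0 = U"
    by (simp_all add: A_def)
  have valid: "valid_algorithm n A"
    using K d U(1) V(1) W by (auto simp: valid_algorithm_def A_def intro: unitary_mat_mult)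
  have accept: "accept_prob n A y = ((fst (grover e K) - 1) / (2 * real K))\<^sup>2"
    if e: "e = (\<Sum>i<n. (p i)\<^sup>2 * of_bool (x ! i \<noteq> y ! i))" for y e
  proof -
    let ?S = "\<lambda>j. real_state n K (grover_state K p e (\<lambda>i. x ! i \<noteq> y ! i) j)"
    have step: "W j *\<^sub>v (query_mat n K y *\<^sub>v ?S j) = ?S (Suc j)" for j
    proof -
      have "W j *\<^sub>v (query_mat n K y *\<^sub>v ?S j)
          = phase_mat n K j *\<^sub>v (diffusion_mat n K p *\<^sub>v (query_mat n K (map Not x) *\<^sub>v (query_mat n K y *\<^sub>v ?S j)))"
      proof -
        have c: "query_mat n K y *\<^sub>v ?S j \<in> carrier_vec ?d" "phase_mat n K j \<in> carrier_mat ?d ?d"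
          "diffusion_mat n K p \<in> carrier_mat ?d ?d" "query_mat n K (map Not x) \<in> carrier_mat ?d ?d"
          by (intro query_vec_carrier real_state_carrier) (simp_all add: phase_mat_def diffusion_mat_def reflection_mat_def query_mat_def)
        show ?thesis
          unfolding W_def assoc_mult_mat_vec[OF c(2) mult_carrier_mat[OF c(3,4)] c(1)]
            assoc_mult_mat_vec[OF c(3,4,1)] ..
      qed
      then show ?thesis using grover_step[OF x p e] by simp
    qed
    have init: "state_after n A y 0 = ?S 0"
    proof (rule eq_vecI)
      show "dim_vec (state_after n A y 0) = dim_vec (?S 0)"
        using unitary_mat_carrier[OF U(1)] by (auto simp: A_simps real_state_def)
      fix r assume "r < dim_vec (?S 0)"
      then have r: "r < ?d" by (simp add: real_state_def)
      have "state_after n A y 0 $ r = (\<Sum>c<?d. U $$ (r, c) * unit_vec ?d 0 $ c)"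
        using r mult_mat_vec_index[OF unitary_mat_carrier[OF U(1)] unit_vec_carrier r]
        by (simp add: A_simps basis_index_def)
      also have "\<dots> = (\<Sum>c<?d. if c = 0 then U $$ (r, c) else 0)"
        using d by (intro sum.cong) auto
      also have "\<dots> = of_real (s r)" using d U(2) r by simp
      also have "\<dots> = ?S 0 $ r" using r by (simp add: real_state_def s_def grover_state_def)
      finally show "state_after n A y 0 $ r = ?S 0 $ r" .
    qed
    have mid: "state_after n A y j = ?S j" if "j < K" for j
      using that
    proof (induction j)
      case 0
      show ?case by (rule init)
    next
      case (Suc j)
      then have "unitaries A (Suc j) = W j" by (simp add: A_def)
      then show ?case using Suc step by (simp add: A_simps)
    qed
    obtain k where k: "K = Suc k" using K gr0_implies_Suc by blast
    have fin: "state_after n A y K = V *\<^sub>v ?S K"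
    proof -
      have "unitaries A (Suc k) = V * W k" by (simp add: A_def k)
      then have "state_after n A y (Suc k) = (V * W k) *\<^sub>v (query_mat n K y *\<^sub>v ?S k)"
        using mid[of k] k by (simp add: A_simps)
      also have "\<dots> = V *\<^sub>v (W k *\<^sub>v (query_mat n K y *\<^sub>v ?S k))"
        by (rule assoc_mult_mat_vec[OF unitary_mat_carrier[OF V(1)] unitary_mat_carrier[OF W]
              query_vec_carrier[OF real_state_carrier]])
      also have "\<dots> = V *\<^sub>v ?S (Suc k)" by (simp only: step)
      finally show ?thesis by (simp only: k[symmetric])
    qed
    have "state_after n A y K $ 0 = (\<Sum>c<?d. V $$ (0, c) * ?S K $ c)"
      unfolding fin by (rule mult_mat_vec_index[OF unitary_mat_carrier[OF V(1)] real_state_carrier d])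
    also have "\<dots> = of_real (\<Sum>c<?d. t c * grover_state K p e (\<lambda>i. x ! i \<noteq> y ! i) K (query_pos K c) (answer_bit K c) (c mod K))"
      unfolding of_real_sum by (intro sum.cong refl) (simp add: V(2) real_state_def)
    also have "(\<Sum>c<?d. t c * grover_state K p e (\<lambda>i. x ! i \<noteq> y ! i) K (query_pos K c) (answer_bit K c) (c mod K))
        = (\<Sum>i<n. \<Sum>z<K. p i / sqrt (2 * real K) * grover_state K p e (\<lambda>i. x ! i \<noteq> y ! i) K i False z
          + p i / sqrt (2 * real K) * grover_state K p e (\<lambda>i. x ! i \<noteq> y ! i) K i True z)"
      unfolding t_def
      by (rule state_sum[of "\<lambda>i b z. p i / sqrt (2 * real K) * grover_state K p e (\<lambda>i. x ! i \<noteq> y ! i) K i b z"])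
    also have "\<dots> = (\<Sum>i<n. \<Sum>z<K. ((p i)\<^sup>2 * of_bool (x ! i \<noteq> y ! i) * fst (grover e (Suc z))
        + ((p i)\<^sup>2 - (p i)\<^sup>2 * of_bool (x ! i \<noteq> y ! i)) * snd (grover e (Suc z))) / real K)"
      by (intro sum.cong refl)
        (auto simp: grover_state_def min.absorb2 power2_eq_square field_simps simp del: grover.simps)
    also have "\<dots> = (\<Sum>z<K. (e * fst (grover e (Suc z)) + (1 - e) * snd (grover e (Suc z))) / real K)"
      unfolding e p[symmetric]
      by (subst sum.swap) (simp add: sum_divide_distrib[symmetric] sum.distrib sum_subtractf sum_distrib_right[symmetric] del: grover.simps)
    also have "\<dots> = (fst (grover e K) - 1) / (2 * real K)"
      unfolding sum_divide_distrib[symmetric] grover_overlap_sum by simp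
    finally have "cmod (state_after n A y K $ 0) = \<bar>(fst (grover e K) - 1) / (2 * real K)\<bar>"
      by (simp only: norm_of_real)
    then show ?thesis
      by (simp add: accept_prob_def A_simps power_divide)
  qed
  have "accept_prob n A x = 1"
    using accept[of 0 x] K by (simp add: grover_unmarked)
  moreover have "reject_prob n A y \<ge> 1 / 2" if y: "y \<in> cube n" "f y \<noteq> f x" for y
  proof -
    define e where "e = (\<Sum>i<n. (p i)\<^sup>2 * of_bool (x ! i \<noteq> y ! i))"
    define a where "a = fst (grover e K)"
    have Ke: "2 \<le> (real K)\<^sup>2 * e" using marked[OF y] by (simp add: e_def)
    have "e \<le> (\<Sum>i<n. (p i)\<^sup>2)" unfolding e_def by (intro sum_mono) auto
    then have e1: "e \<le> 1" using p by simp
    then have "0 \<le> (1 - e) * (snd (grover e K))\<^sup>2" by simp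
    \<comment> \<open>Hence \<open>2 * a\<^sup>2 \<le> K\<^sup>2\<close>. As
      \<open>e \<le> 1\<close> also gives \<open>2 \<le> K\<^sup>2\<close>, the bound
      \<open>2 * a\<^sup>2 + 2\<close> on \<open>(a - 1)\<^sup>2\<close> is at most
      \<open>2 * K\<^sup>2\<close>, which is acceptance probability at most 1/2.\<close>
    then have "e * a\<^sup>2 \<le> 1" using grover_norm[of e K] by (simp add: a_def)
    then have "(real K)\<^sup>2 * (e * a\<^sup>2) \<le> (real K)\<^sup>2 * 1" by (intro mult_left_mono) auto
    moreover have "2 * a\<^sup>2 \<le> (real K)\<^sup>2 * e * a\<^sup>2" using Ke by (intro mult_right_mono) auto
    ultimately have "2 * a\<^sup>2 \<le> (real K)\<^sup>2" by (simp add: mult.assoc)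
    moreover have "2 \<le> (real K)\<^sup>2"
      using Ke mult_left_mono[OF e1, of "(real K)\<^sup>2"] by simp
    moreover have "(a - 1)\<^sup>2 \<le> 2 * a\<^sup>2 + 2"
      using zero_le_power2[of "a + 1"] by (simp add: power2_eq_square algebra_simps)
    ultimately have "(a - 1)\<^sup>2 \<le> 2 * (real K)\<^sup>2" by linarith
    then have "((a - 1) / (2 * real K))\<^sup>2 \<le> 1 / 2"
      using K by (simp add: power_divide power_mult_distrib field_simps)
    then show ?thesis using accept[OF e_def] by (simp add: reject_prob_def a_def)
  qed
  ultimately have "quantum_verifier n f x A"
    using valid by (simp add: quantum_verifier_def)
  then show ?thesis using A_simps by blast
qed

section \<open>Quantum certificate complexity of the family\<close>

lemma qcert_cong: "qcert n f = qcert n h" if "\<And>x. x \<in> cube n \<Longrightarrow> f x = h x"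
proof -
  have "quantum_verifier n f x A = quantum_verifier n h x A" if "x \<in> cube n" for x A
    unfolding quantum_verifier_def using \<open>\<And>x. x \<in> cube n \<Longrightarrow> f x = h x\<close> that by (simp cong: ball_cong)
  then have "qcert_at n f x = qcert_at n h x" if "x \<in> cube n" for x
    using that by (simp add: qcert_at_def)
  then show ?thesis unfolding qcert_def by (simp cong: image_cong)
qed

text \<open>Normalised weights give every input of the other value marked weight at least
  \<open>1 / W\<close>, where the total \<open>W\<close> is at most \<open>R\<close>. The input
  \<open>y\<close> of the other value guarantees \<open>1 \<le> W\<close>, so normalisation is
  possible.\<close>

lemma fractional_certificate_verifier:
  assumes x: "x \<in> cube n" and w: "fractional_certificate n f x w" and R: "(\<Sum>i<n. w i) \<le> R"
    and y: "y \<in> cube n" "f y \<noteq> f x" and K: "2 * R \<le> (real K)\<^sup>2" and n: "0 < n"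
  shows "\<exists>A. quantum_verifier n f x A \<and> queries A = K"
proof -
  define W where "W = (\<Sum>i<n. w i)"
  have w0: "0 \<le> w i" for i using w by (simp add: fractional_certificate_def)
  have "1 \<le> (\<Sum>i<n. w i * of_bool (y ! i \<noteq> x ! i))"
    using w y by (simp add: fractional_certificate_def)
  also have "\<dots> \<le> W" unfolding W_def using w0 by (intro sum_mono) auto
  finally have W: "1 \<le> W" .
  have sq: "(sqrt (w i / W))\<^sup>2 = w i / W" for i using w0 W by simp
  show ?thesis
  proof (rule ex_quantum_verifier[where p = "\<lambda>i. sqrt (w i / W)"])
    show "(\<Sum>i<n. (sqrt (w i / W))\<^sup>2) = 1"
      unfolding sq sum_divide_distrib[symmetric] using W by (simp add: W_def)
    show "0 < K" using K R W by (auto simp: W_def intro: gr0I)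
    fix y assume y: "y \<in> cube n" "f y \<noteq> f x"
    have "1 \<le> (\<Sum>i<n. w i * of_bool (y ! i \<noteq> x ! i))"
      using w y unfolding fractional_certificate_def by blast
    also have "\<dots> = (\<Sum>i<n. w i * of_bool (x ! i \<noteq> y ! i))"
      by (intro sum.cong refl) auto
    finally have "1 \<le> (\<Sum>i<n. w i * of_bool (x ! i \<noteq> y ! i))" .
    then have "2 * W * (1 / W) \<le> (real K)\<^sup>2 * ((\<Sum>i<n. w i * of_bool (x ! i \<noteq> y ! i)) / W)"
      using K R W by (intro mult_mono divide_right_mono) (auto simp: W_def)
    then show "2 \<le> (real K)\<^sup>2 * (\<Sum>i<n. (sqrt (w i / W))\<^sup>2 * of_bool (x ! i \<noteq> y ! i))"
      using W unfolding sq by (simp only: times_divide_eq_left sum_divide_distrib) simp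
  qed (fact x n)+
qed

lemma ex_G_verifier:
  assumes x: "x \<in> cube (29 ^ t)"
  shows "\<exists>A. quantum_verifier (29 ^ t) (G t) x A \<and> real (queries A) \<le> 3 * sqrt (17 ^ t)"
proof -
  define K where "K = nat \<lceil>sqrt (2 * 17 ^ t)\<rceil>"
  have K: "sqrt (2 * 17 ^ t) \<le> real K" "real K \<le> sqrt (2 * 17 ^ t) + 1"
    unfolding K_def by (auto simp: real_nat_ceiling_ge)
  have "(sqrt (2 * 17 ^ t))\<^sup>2 \<le> (real K)\<^sup>2" using K(1) by (intro power_mono) auto
  then have K2: "2 * 17 ^ t \<le> (real K)\<^sup>2" by simp
  obtain w where w: "fractional_certificate (29 ^ t) (G t) x w" "(\<Sum>i<29 ^ t. w i) \<le> 17 ^ t"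
    using G_fractional_certificate[OF x] by blast
  \<comment> \<open>The family for the opposite value is used only to exhibit an input where
    \<open>G t\<close> differs from its value at \<open>x\<close>.\<close>
  obtain y where y: "y \<in> cube (29 ^ t)" "G t y \<noteq> G t x"
    using G_sensitive_family[of t "\<not> G t x"] by auto
  have "sqrt (2 * 17 ^ t) \<le> 2 * sqrt (17 ^ t)"
    by (simp add: real_sqrt_mult sqrt2_less_2 less_imp_le)
  moreover have "1 \<le> sqrt (17 ^ t)" by simp
  ultimately have "real K \<le> 3 * sqrt (17 ^ t)" using K(2) by linarith
  then show ?thesis
    using fractional_certificate_verifier[OF x w y K2] by auto
qed

lemma qcert_at_witness:
  assumes "\<exists>A. quantum_verifier n f x A"
  shows "\<exists>A. quantum_verifier n f x A \<and> queries A = qcert_at n f x"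
  unfolding qcert_at_def
  using assms LeastI_ex[of "\<lambda>T. \<exists>A. quantum_verifier n f x A \<and> queries A = T"] by blast

lemma qcert_G_upper: "real (qcert (29 ^ t) (G t)) \<le> 3 * sqrt 17 ^ t"
proof -
  have "real (qcert_at (29 ^ t) (G t) x) \<le> 3 * sqrt (17 ^ t)" if x: "x \<in> cube (29 ^ t)" for x
  proof -
    obtain A where A: "quantum_verifier (29 ^ t) (G t) x A" "real (queries A) \<le> 3 * sqrt (17 ^ t)"
      using ex_G_verifier[OF x] by blast
    have "qcert_at (29 ^ t) (G t) x \<le> queries A"
      unfolding qcert_at_def using A(1) by (intro Least_le) blast
    then show ?thesis using A(2) by linarith
  qed
  moreover have "qcert (29 ^ t) (G t) \<in> qcert_at (29 ^ t) (G t) ` cube (29 ^ t)"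
    unfolding qcert_def using finite_cube cube_nonempty by (intro Max_in) auto
  ultimately show ?thesis by (auto simp: real_sqrt_power)
qed

lemma qcert_G_lower: "sqrt 17 ^ t \<le> 2 * sqrt 2 * real (qcert (29 ^ t) (G t))"
proof -
  obtain x Y where x: "x \<in> cube (29 ^ t)" and Y: "sensitive_family (29 ^ t) (G t) x (17 ^ t) Y"
    using G_sensitive_family[of t True] by blast
  obtain A where A: "quantum_verifier (29 ^ t) (G t) x A" "queries A = qcert_at (29 ^ t) (G t) x"
    using qcert_at_witness ex_G_verifier[OF x] by blast
  have "sqrt 17 ^ t = sqrt (real (17 ^ t))" by (simp add: real_sqrt_power)
  also have "\<dots> \<le> 2 * sqrt 2 * real (qcert_at (29 ^ t) (G t) x)"
    using quantum_verifier_lower_bound[OF A(1) _ Y] A(2) by simp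
  also have "\<dots> \<le> 2 * sqrt 2 * real (qcert (29 ^ t) (G t))"
    unfolding qcert_def using finite_cube x by (intro mult_left_mono) (auto intro: Max_ge)
  finally show ?thesis .
qed


section \<open>The exponent\<close>

definition exponent :: real where "exponent = 2 * ln L / ln 17"

text \<open>The exponent equals \<open>2 + ln u / ln 17\<close>, so the bounds say that
  \<open>ln u / ln 17\<close> lies between 9/44 and 8/39, that is \<open>17 ^ 9 < u ^ 44\<close> and
  \<open>u ^ 39 < 17 ^ 8\<close>. These fractions have small denominators and lie within the
  required window around 0.205.\<close>

lemma exponent_bounds: "97 / 44 < exponent" "exponent < 86 / 39"
proof -
  define u where "u = L * L / 289"
  have u_eq: "u = (13 * L + 221) / 289" by (simp add: u_def L_square)
  have "32.449 \<le> sqrt 1053" by (rule real_le_rsqrt) (simp add: power2_eq_square)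
  then have lo: "1.7868 \<le> u" by (simp add: u_eq L_def)
  have "sqrt 1053 \<le> 32.45" by (rule real_le_lsqrt) (simp_all add: power2_eq_square)
  then have hi: "u \<le> 1.787" by (simp add: u_eq L_def)
  have u0: "0 < u" using lo by simp
  have ln_u: "ln u = 2 * ln L - 2 * ln 17"
    using L_ge ln_realpow[of 17 2] by (simp add: u_def ln_div ln_mult)
  \<comment> \<open>Rounding to an integer before taking the fourth power keeps the numerals small;
    \<open>592 ^ 4\<close> still exceeds \<open>17 ^ 9\<close>. Likewise \<open>1900 ^ 3\<close>
    stays below \<open>17 ^ 8\<close>.\<close>
  have "592 \<le> (1.7868 :: real) ^ 11" by (simp add: power_divide)
  also have "\<dots> \<le> u ^ 11" using lo by (intro power_mono) auto
  finally have "592 ^ 4 \<le> (u ^ 11) ^ 4" by (intro power_mono) auto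
  then have "17 ^ 9 < u ^ 44" by (simp add: power_mult[symmetric])
  then have "ln (17 ^ 9) < ln (u ^ 44)" using lo by (subst ln_less_cancel_iff) auto
  then have "real 9 * ln 17 < real 44 * ln u" by (simp only: ln_realpow)
  then show "97 / 44 < exponent" by (simp add: ln_u exponent_def field_simps)
  have "u ^ 13 \<le> 1.787 ^ 13" using lo hi by (intro power_mono) auto
  also have "\<dots> \<le> (1900 :: real)" by (simp add: power_divide)
  finally have "(u ^ 13) ^ 3 \<le> 1900 ^ 3" using lo by (intro power_mono) auto
  then have "u ^ 39 < 17 ^ 8" by (simp add: power_mult[symmetric])
  then have "ln (u ^ 39) < ln (17 ^ 8)" using lo by (subst ln_less_cancel_iff) auto
  then have "real 39 * ln u < real 8 * ln 17" by (simp only: ln_realpow)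
  then show "exponent < 86 / 39" by (simp add: ln_u exponent_def field_simps)
qed

lemma sqrt_17_powr_exponent: "(sqrt 17 ^ t) powr exponent = L ^ t"
proof -
  have "sqrt 17 powr exponent = exp (ln L)"
    by (simp add: powr_def exponent_def ln_sqrt)
  then have "sqrt 17 powr exponent = L" using L_ge by simp
  moreover have "(sqrt 17 ^ t) powr exponent = (sqrt 17 powr exponent) ^ t"
    by (simp add: powr_powr mult.commute flip: powr_realpow)
  ultimately show ?thesis by simp
qed

theorem mainTheorem5:
  shows "\<exists>\<alpha>::real. \<bar>\<alpha> - 2.205\<bar> < 0.0005 \<and>
    (\<lambda>t. real (cert (29 ^ t) (g t))) \<in> \<Theta>(\<lambda>t. real (qcert (29 ^ t) (g t)) powr \<alpha>)"
proof (intro exI[of _ exponent] conjI)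
  have pos: "0 \<le> exponent" using exponent_bounds by simp
  show "\<bar>exponent - 2.205\<bar> < 0.0005" unfolding abs_less_iff using exponent_bounds by (auto simp: field_simps)
  let ?C = "\<lambda>t. real (cert (29 ^ t) (g t))" and ?Q = "\<lambda>t. real (qcert (29 ^ t) (g t))"
  \<comment> \<open>Index 0 is excluded because \<open>g 0\<close> is a dummy that differs from
    \<open>G 0\<close>; an asymptotic statement does not see it.\<close>
  have eq: "cert (29 ^ t) (g t) = cert (29 ^ t) (G t)" "qcert (29 ^ t) (g t) = qcert (29 ^ t) (G t)"
    if "t \<ge> 1" for t
  proof -
    have "g t x = G t x" if "x \<in> cube (29 ^ t)" for x
      using \<open>t \<ge> 1\<close> that g_eq_G[of x "t - 1"] by simp
    then show "cert (29 ^ t) (g t) = cert (29 ^ t) (G t)" "qcert (29 ^ t) (g t) = qcert (29 ^ t) (G t)"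
      by (intro cert_cong qcert_cong; simp)+
  qed
  have upper: "?C t \<le> L * (2 * sqrt 2) powr exponent * ?Q t powr exponent" if t: "t \<ge> 1" for t
  proof -
    have "L ^ t \<le> (2 * sqrt 2 * ?Q t) powr exponent"
      unfolding sqrt_17_powr_exponent[symmetric] eq[OF t]
      using pos qcert_G_lower by (intro powr_mono2) auto
    then have "L * L ^ t \<le> L * (2 * sqrt 2 * ?Q t) powr exponent"
      using L_ge by (intro mult_left_mono) auto
    then show ?thesis using cert_G_upper[of t] by (simp add: eq[OF t] powr_mult mult.assoc)
  qed
  have lower: "?Q t powr exponent \<le> 3 powr exponent * ?C t" if t: "t \<ge> 1" for t
  proof -
    have "?Q t powr exponent \<le> (3 * sqrt 17 ^ t) powr exponent"
      unfolding eq[OF t] using pos qcert_G_upper by (intro powr_mono2) auto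
    also have "\<dots> = 3 powr exponent * L ^ t"
      by (simp add: powr_mult sqrt_17_powr_exponent)
    also have "\<dots> \<le> 3 powr exponent * ?C t"
      using cert_G_lower[of t] by (intro mult_left_mono) (auto simp: eq[OF t])
    finally show ?thesis .
  qed
  show "?C \<in> \<Theta>(\<lambda>t. ?Q t powr exponent)"
  proof (rule bigthetaI)
    show "?C \<in> O(\<lambda>t. ?Q t powr exponent)"
      using upper by (intro bigoI[of _ "L * (2 * sqrt 2) powr exponent"] eventually_sequentiallyI[of 1]) auto
    have "(\<lambda>t. ?Q t powr exponent) \<in> O(?C)"
      using lower by (intro bigoI[of _ "3 powr exponent"] eventually_sequentiallyI[of 1]) auto
    then show "?C \<in> \<Omega>(\<lambda>t. ?Q t powr exponent)" by (simp add: bigomega_iff_bigo)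
  qed
qed

end
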